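(* Let $M$ be an $N$-dimensional smooth manifold ($N\ge2$) with a Riemannian metric $a_{ij}(x)$ and a 1-form $b_i(x)$ of unit Riemannian length, $a^{ij}b_ib_j=1$. Let $g$ be a constant with $-2<g<2$, and let $K(x,y)$ be the Finsleroid–Finsler metric function determined by $a_{ij}$, $b_i$ and $g$. Assume that $$\nabla_jb_i=k\,(a_{ij}-b_ib_j)$$ for some scalar function $k=k(x)$ on $M$, where $\nabla$ is the Levi-Civita covariant derivative of $a_{ij}$. Then, at all $(x,y)\in TM\setminus0$ with $q(x,y)\ne0$, the geodesic spray coefficients $G^i=\gamma^i{}_{nm}y^ny^m$ of $K$ are of Landsberg type, that is, $$G^i=c\,q\,v^i+a^i{}_{km}y^ky^m ,\qquad\text{with } c=c(x)=k(x)\,g,$$ and the coefficients $G^i{}_{kmn}=\partial^3G^i/\partial y^k\partial y^m\partial y^n$ are $$G^i{}_{kmn}=\frac{c}{q}\bigl(\eta_k{}^i\eta_{mn}+\eta_m{}^i\eta_{kn}+\eta_n{}^i\eta_{km}\bigr),\qquad c=kg.$$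
   Context: Conventions. $(x^i,y^i)$ are standard local coordinates on $TM$, and repeated indices are summed. $a^{ij}$ is the inverse of $a_{ij}$, and $a^k{}_{ij}=\frac12a^{kn}(\partial_ja_{ni}+\partial_ia_{nj}-\partial_na_{ji})$ are the Riemannian Christoffel symbols ($\partial_j=\partial/\partial x^j$). Notation: $b^i=a^{ij}b_j$; $b=b_iy^i$; $S=\sqrt{a_{ij}y^iy^j}$; $r_{ij}=a_{ij}-b_ib_j$; $r^i{}_j=\delta^i{}_j-b^ib_j$; $q=\sqrt{r_{ij}y^iy^j}=\sqrt{S^2-b^2}$; $v^i=y^i-b\,b^i$; $v_i=a_{ij}v^j$; $\eta_j{}^i=\eta^i{}_j=r^i{}_j-\frac1{q^2}v^iv_j$; $\eta_{ij}=r_{ij}-\frac1{q^2}v_iv_j$. Finsleroid–Finsler metric function: with $h=\sqrt{1-\frac14g^2}$ and $G=g/h$ (a scalar, not to be confused with the $G^i$), $$K(x,y)=\sqrt{B}\;e^{\frac12G\Phi},\qquad B=b^2+g\,q\,b+q^2,$$ $$\Phi=\pm\frac{\pi}{2}+\arctan\frac G2-\arctan\Bigl(\frac{q+\frac g2b}{hb}\Bigr),$$ with the sign $+$ if $b>0$ and $-$ if $b<0$; at $b=0$ (with $y\neq0$), $\Phi$ takes the common limit value $\arctan\frac G2$. $K$ is smooth where $y\neq0$ is not proportional to the vector $b^i$, i.e. where $q\ne0$. The Finslerian metric tensor is $g_{ij}=\frac12\,\partial^2K^2/\partial y^i\partial y^j$, with inverse $g^{ij}$. The Finslerian Christoffel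 symbols are $\gamma^k{}_{ij}=\frac12g^{kn}(\partial_jg_{ni}+\partial_ig_{nj}-\partial_ng_{ji})$, and the geodesic spray coefficients are $G^k=\gamma^k{}_{ij}y^iy^j$ (no factor $\frac12$). Spray coefficients are called of Landsberg type if they have the form $G^i=c(x)\,q\,v^i+a^i{}_{km}y^ky^m$ for some scalar $c(x)$. *)

theory Defs
  imports "HOL-Analysis.Analysis"
begin

definition partial :: "'n::finite \<Rightarrow> (real ^ 'n \<Rightarrow> real) \<Rightarrow> real ^ 'n \<Rightarrow> real" where
  "partial i f x = deriv (\<lambda>t. f (x + t *\<^sub>R axis i 1)) 0"

text \<open>Continuous differentiability of order \<open>r\<close>; only meant for open \<open>U\<close>.\<close>

primrec Ck_on :: "nat \<Rightarrow> (real ^ 'n::finite \<Rightarrow> real) \<Rightarrow> (real ^ 'n) set \<Rightarrow> bool" where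
  "Ck_on 0 f U = continuous_on U f"
| "Ck_on (Suc r) f U = ((\<forall>x\<in>U. f differentiable (at x)) \<and> (\<forall>i. Ck_on r (partial i f) U))"

definition smooth_on :: "(real ^ 'n::finite \<Rightarrow> real) \<Rightarrow> (real ^ 'n) set \<Rightarrow> bool" where
  "smooth_on f U \<longleftrightarrow> (\<forall>r. Ck_on r f U)"

text \<open>A chart is a domain together with a coordinate map. The values of the coordinate map outside
  the domain are irrelevant.\<close>

type_synonym ('m, 'n) chart = "'m set \<times> ('m \<Rightarrow> real ^ 'n)"

abbreviation chart_dom :: "('m, 'n) chart \<Rightarrow> 'm set" where
  "chart_dom \<equiv> fst"

abbreviation coord :: "('m, 'n) chart \<Rightarrow> 'm \<Rightarrow> real ^ 'n" where
  "coord \<equiv> snd"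

definition overlap :: "('m, 'n) chart \<Rightarrow> ('m, 'n) chart \<Rightarrow> (real ^ 'n) set" where
  "overlap ch ch' = coord ch ` (chart_dom ch \<inter> chart_dom ch')"

definition transition :: "('m, 'n) chart \<Rightarrow> ('m, 'n) chart \<Rightarrow> real ^ 'n \<Rightarrow> real ^ 'n" where
  "transition ch ch' x = coord ch' (inv_into (chart_dom ch) (coord ch) x)"

text \<open>\<open>jacobian ch ch' m i\<close> is the derivative of the \<open>m\<close>-th \<open>ch'\<close>-coordinate
  with respect to the \<open>i\<close>-th \<open>ch\<close>-coordinate.\<close>

definition jacobian ::
  "('m, 'n::finite) chart \<Rightarrow> ('m, 'n) chart \<Rightarrow> 'n \<Rightarrow> 'n \<Rightarrow> real ^ 'n \<Rightarrow> real" where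
  "jacobian ch ch' m i x = partial i (\<lambda>z. transition ch ch' z $ m) x"

definition smooth_manifold :: "'m topology \<Rightarrow> ('m, 'n::finite) chart set \<Rightarrow> bool" where
  "smooth_manifold M atlas \<longleftrightarrow>
     Hausdorff_space M \<and> second_countable M \<and>
     (\<Union>ch\<in>atlas. chart_dom ch) = topspace M \<and>
     (\<forall>ch\<in>atlas. openin M (chart_dom ch) \<and> open (coord ch ` chart_dom ch) \<and>
        homeomorphic_map (subtopology M (chart_dom ch))
          (top_of_set (coord ch ` chart_dom ch)) (coord ch)) \<and>
     (\<forall>ch\<in>atlas. \<forall>ch'\<in>atlas. \<forall>m. smooth_on (\<lambda>x. transition ch ch' x $ m) (overlap ch ch'))"

text \<open>Tensor fields are given by their components in every chart of the atlas, as functions of the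
  coordinates, subject to the usual transformation laws.\<close>

definition riemannian_metric ::
  "('m, 'n::finite) chart set \<Rightarrow> (('m, 'n) chart \<Rightarrow> real ^ 'n \<Rightarrow> real ^ 'n ^ 'n) \<Rightarrow> bool" where
  "riemannian_metric atlas a \<longleftrightarrow>
     (\<forall>ch\<in>atlas.
        (\<forall>i j. smooth_on (\<lambda>x. a ch x $ i $ j) (coord ch ` chart_dom ch)) \<and>
        (\<forall>x \<in> coord ch ` chart_dom ch.
           (\<forall>i j. a ch x $ i $ j = a ch x $ j $ i) \<and>
           (\<forall>y. y \<noteq> 0 \<longrightarrow> (\<Sum>i\<in>UNIV. \<Sum>j\<in>UNIV. a ch x $ i $ j * y $ i * y $ j) > 0))) \<and>
     (\<forall>ch\<in>atlas. \<forall>ch'\<in>atlas. \<forall>x \<in> overlap ch ch'. \<forall>i j.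
        a ch x $ i $ j =
          (\<Sum>m\<in>UNIV. \<Sum>n\<in>UNIV. jacobian ch ch' m i x * jacobian ch ch' n j x *
             a ch' (transition ch ch' x) $ m $ n))"

definition one_form ::
  "('m, 'n::finite) chart set \<Rightarrow> (('m, 'n) chart \<Rightarrow> real ^ 'n \<Rightarrow> real ^ 'n) \<Rightarrow> bool" where
  "one_form atlas b \<longleftrightarrow>
     (\<forall>ch\<in>atlas. \<forall>i. smooth_on (\<lambda>x. b ch x $ i) (coord ch ` chart_dom ch)) \<and>
     (\<forall>ch\<in>atlas. \<forall>ch'\<in>atlas. \<forall>x \<in> overlap ch ch'. \<forall>i.
        b ch x $ i = (\<Sum>m\<in>UNIV. jacobian ch ch' m i x * b ch' (transition ch ch' x) $ m))"

text \<open>Algebra at one point: \<open>A\<close> is the matrix of \<open>a\<^sub>i\<^sub>j\<close> and \<open>\<beta>\<close> the vector of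
  the \<open>b\<^sub>i\<close> there. The suffixes \<open>low\<close> and \<open>mix\<close> stand for two lower
  indices and for one upper (first argument) and one lower index.\<close>

definition covector_norm_sq :: "real ^ 'n ^ 'n \<Rightarrow> real ^ 'n \<Rightarrow> real" where
  "covector_norm_sq A \<beta> = (\<Sum>i\<in>UNIV. \<Sum>j\<in>UNIV. matrix_inv A $ i $ j * \<beta> $ i * \<beta> $ j)"

definition b_up :: "real ^ 'n ^ 'n \<Rightarrow> real ^ 'n \<Rightarrow> real ^ 'n" where
  "b_up A \<beta> = (\<chi> i. \<Sum>j\<in>UNIV. matrix_inv A $ i $ j * \<beta> $ j)"

definition b_val :: "real ^ 'n \<Rightarrow> real ^ 'n \<Rightarrow> real" where
  "b_val \<beta> y = (\<Sum>i\<in>UNIV. \<beta> $ i * y $ i)"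

definition r_low :: "real ^ 'n ^ 'n \<Rightarrow> real ^ 'n \<Rightarrow> 'n \<Rightarrow> 'n \<Rightarrow> real" where
  "r_low A \<beta> i j = A $ i $ j - \<beta> $ i * \<beta> $ j"

definition r_mix :: "real ^ 'n ^ 'n \<Rightarrow> real ^ 'n \<Rightarrow> 'n \<Rightarrow> 'n \<Rightarrow> real" where
  "r_mix A \<beta> i j = (if i = j then 1 else 0) - b_up A \<beta> $ i * \<beta> $ j"

definition q_val :: "real ^ 'n ^ 'n \<Rightarrow> real ^ 'n \<Rightarrow> real ^ 'n \<Rightarrow> real" where
  "q_val A \<beta> y = sqrt (\<Sum>i\<in>UNIV. \<Sum>j\<in>UNIV. r_low A \<beta> i j * y $ i * y $ j)"

definition v_up :: "real ^ 'n ^ 'n \<Rightarrow> real ^ 'n \<Rightarrow> real ^ 'n \<Rightarrow> real ^ 'n" where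
  "v_up A \<beta> y = (\<chi> i. y $ i - b_val \<beta> y * b_up A \<beta> $ i)"

definition v_low :: "real ^ 'n ^ 'n \<Rightarrow> real ^ 'n \<Rightarrow> real ^ 'n \<Rightarrow> real ^ 'n" where
  "v_low A \<beta> y = (\<chi> i. \<Sum>j\<in>UNIV. A $ i $ j * v_up A \<beta> y $ j)"

definition eta_mix :: "real ^ 'n ^ 'n \<Rightarrow> real ^ 'n \<Rightarrow> real ^ 'n \<Rightarrow> 'n \<Rightarrow> 'n \<Rightarrow> real" where
  "eta_mix A \<beta> y i j =
     r_mix A \<beta> i j - 1 / (q_val A \<beta> y)\<^sup>2 * v_up A \<beta> y $ i * v_low A \<beta> y $ j"

definition eta_low :: "real ^ 'n ^ 'n \<Rightarrow> real ^ 'n \<Rightarrow> real ^ 'n \<Rightarrow> 'n \<Rightarrow> 'n \<Rightarrow> real" where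
  "eta_low A \<beta> y i j =
     r_low A \<beta> i j - 1 / (q_val A \<beta> y)\<^sup>2 * v_low A \<beta> y $ i * v_low A \<beta> y $ j"

definition h_par :: "real \<Rightarrow> real" where
  "h_par g = sqrt (1 - 1 / 4 * g\<^sup>2)"

definition G_par :: "real \<Rightarrow> real" where
  "G_par g = g / h_par g"

definition B_fun :: "real \<Rightarrow> real ^ 'n ^ 'n \<Rightarrow> real ^ 'n \<Rightarrow> real ^ 'n \<Rightarrow> real" where
  "B_fun g A \<beta> y =
     (b_val \<beta> y)\<^sup>2 + g * q_val A \<beta> y * b_val \<beta> y + (q_val A \<beta> y)\<^sup>2"

definition Phi_fun :: "real \<Rightarrow> real ^ 'n ^ 'n \<Rightarrow> real ^ 'n \<Rightarrow> real ^ 'n \<Rightarrow> real" where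
  "Phi_fun g A \<beta> y =
     (let b = b_val \<beta> y; q = q_val A \<beta> y in
      if b > 0 then
        pi / 2 + arctan (G_par g / 2) - arctan ((q + g / 2 * b) / (h_par g * b))
      else if b < 0 then
        - (pi / 2) + arctan (G_par g / 2) - arctan ((q + g / 2 * b) / (h_par g * b))
      else arctan (G_par g / 2))"

definition finsleroid :: "real \<Rightarrow> real ^ 'n ^ 'n \<Rightarrow> real ^ 'n \<Rightarrow> real ^ 'n \<Rightarrow> real" where
  "finsleroid g A \<beta> y = sqrt (B_fun g A \<beta> y) * exp (1 / 2 * G_par g * Phi_fun g A \<beta> y)"

text \<open>Differential geometry in one chart: \<open>a\<close> and \<open>b\<close> are now functions of the
  coordinates \<open>x\<close>.\<close>

definition christoffel :: "(real ^ 'n \<Rightarrow> real ^ 'n ^ 'n) \<Rightarrow> real ^ 'n \<Rightarrow> 'n \<Rightarrow> 'n \<Rightarrow> 'n \<Rightarrow> real" where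
  "christoffel a x k i j =
     1 / 2 * (\<Sum>n\<in>UNIV. matrix_inv (a x) $ k $ n *
       (partial j (\<lambda>z. a z $ n $ i) x + partial i (\<lambda>z. a z $ n $ j) x
          - partial n (\<lambda>z. a z $ j $ i) x))"

text \<open>The component \<open>\<nabla>\<^sub>j b\<^sub>i\<close>, in this order of the indices \<open>j\<close>, \<open>i\<close>.\<close>

definition cov_deriv ::
  "(real ^ 'n \<Rightarrow> real ^ 'n ^ 'n) \<Rightarrow> (real ^ 'n \<Rightarrow> real ^ 'n) \<Rightarrow> real ^ 'n \<Rightarrow> 'n \<Rightarrow> 'n \<Rightarrow> real" where
  "cov_deriv a b x j i =
     partial j (\<lambda>z. b z $ i) x - (\<Sum>k\<in>UNIV. christoffel a x k i j * b x $ k)"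

definition finsler_metric ::
  "real \<Rightarrow> (real ^ 'n \<Rightarrow> real ^ 'n ^ 'n) \<Rightarrow> (real ^ 'n \<Rightarrow> real ^ 'n) \<Rightarrow>
   real ^ 'n \<Rightarrow> real ^ 'n \<Rightarrow> real ^ 'n ^ 'n" where
  "finsler_metric g a b x y =
     (\<chi> i j. 1 / 2 * partial i (partial j (\<lambda>w. (finsleroid g (a x) (b x) w)\<^sup>2)) y)"

text \<open>The Finslerian Christoffel symbols have the Riemannian form, with \<open>y\<close> held fixed.\<close>

definition finsler_christoffel ::
  "real \<Rightarrow> (real ^ 'n \<Rightarrow> real ^ 'n ^ 'n) \<Rightarrow> (real ^ 'n \<Rightarrow> real ^ 'n) \<Rightarrow>
   real ^ 'n \<Rightarrow> real ^ 'n \<Rightarrow> 'n \<Rightarrow> 'n \<Rightarrow> 'n \<Rightarrow> real" where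
  "finsler_christoffel g a b x y = christoffel (\<lambda>z. finsler_metric g a b z y) x"

definition spray ::
  "real \<Rightarrow> (real ^ 'n \<Rightarrow> real ^ 'n ^ 'n) \<Rightarrow> (real ^ 'n \<Rightarrow> real ^ 'n) \<Rightarrow>
   real ^ 'n \<Rightarrow> real ^ 'n \<Rightarrow> 'n \<Rightarrow> real" where
  "spray g a b x y i =
     (\<Sum>n\<in>UNIV. \<Sum>m\<in>UNIV. finsler_christoffel g a b x y i n m * y $ n * y $ m)"

definition spray_deriv3 ::
  "real \<Rightarrow> (real ^ 'n \<Rightarrow> real ^ 'n ^ 'n) \<Rightarrow> (real ^ 'n \<Rightarrow> real ^ 'n) \<Rightarrow>
   real ^ 'n \<Rightarrow> real ^ 'n \<Rightarrow> 'n \<Rightarrow> 'n \<Rightarrow> 'n \<Rightarrow> 'n \<Rightarrow> real" where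
  "spray_deriv3 g a b x y i k m n =
     partial k (partial m (partial n (\<lambda>w. spray g a b x w i))) y"

definition landsberg_spray ::
  "real \<Rightarrow> (real ^ 'n \<Rightarrow> real ^ 'n ^ 'n) \<Rightarrow> (real ^ 'n \<Rightarrow> real ^ 'n) \<Rightarrow>
   real ^ 'n \<Rightarrow> real ^ 'n \<Rightarrow> 'n \<Rightarrow> real" where
  "landsberg_spray c a b x y i =
     c * q_val (a x) (b x) y * v_up (a x) (b x) y $ i +
       (\<Sum>k\<in>UNIV. \<Sum>m\<in>UNIV. christoffel a x i k m * y $ k * y $ m)"

text \<open>Here \<open>G ch x y i\<close> is the \<open>i\<close>-th spray coefficient in the chart \<open>ch\<close>.\<close>

definition landsberg_type ::
  "('m, 'n) chart set \<Rightarrow> (('m, 'n) chart \<Rightarrow> real ^ 'n \<Rightarrow> real ^ 'n ^ 'n) \<Rightarrow>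
   (('m, 'n) chart \<Rightarrow> real ^ 'n \<Rightarrow> real ^ 'n) \<Rightarrow>
   (('m, 'n) chart \<Rightarrow> real ^ 'n \<Rightarrow> real ^ 'n \<Rightarrow> 'n \<Rightarrow> real) \<Rightarrow> bool" where
  "landsberg_type atlas a b G \<longleftrightarrow>
     (\<exists>c :: 'm \<Rightarrow> real. \<forall>ch\<in>atlas. \<forall>p \<in> chart_dom ch. \<forall>y i.
        y \<noteq> 0 \<longrightarrow> q_val (a ch (coord ch p)) (b ch (coord ch p)) y \<noteq> 0 \<longrightarrow>
        G ch (coord ch p) y i = landsberg_spray (c p) (a ch) (b ch) (coord ch p) y i)"

end

theory Submission
  imports Defs
begin

text \<open>Put \<open>J = exp (G \<Phi>)\<close> and \<open>F = K\<^sup>2 = B J\<close>. As functions of \<open>b\<close> and \<open>q > 0\<close> these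
  satisfy \<open>J\<^sub>b = g q J / B\<close> and \<open>J\<^sub>q = - g b J / B\<close>, hence \<open>dF = J (2 g q db + d(S\<^sup>2))\<close>. Half the
  \<open>y\<close>-gradient of \<open>F\<close> is therefore \<open>J (a\<^sub>i\<^sub>j y\<^sup>j + g q b\<^sub>i)\<close>, which also equals \<open>g\<^sub>i\<^sub>j y\<^sup>j\<close>, and
  \<open>g\<^sub>i\<^sub>j\<close> is positive definite. Contracting the Christoffel symbols with \<open>y\<close> twice involves the
  \<open>x\<close>-derivatives of \<open>g\<^sub>i\<^sub>j y\<^sup>j\<close> and \<open>g\<^sub>i\<^sub>j y\<^sup>i y\<^sup>j = F\<close> only. The hypothesis on \<open>\<nabla>b\<close> makes
  \<open>b\<^sub>i\<close> closed and fixes the derivative of \<open>b\<close> along the Riemannian geodesic flow, so that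
  \<open>\<gamma>\<^sub>l\<^sub>n\<^sub>m y\<^sup>n y\<^sup>m = g\<^sub>l\<^sub>i (a\<^sup>i\<^sub>n\<^sub>m y\<^sup>n y\<^sup>m + k g q v\<^sup>i)\<close> is an identity in \<open>b\<close>, \<open>q\<close> and the
  contracted derivatives, and the inverse of \<open>g\<^sub>i\<^sub>j\<close> never has to be computed.\<close>

section \<open>Partial derivatives along the coordinate axes\<close>

abbreviation has_partial ::
  "'n::finite \<Rightarrow> (real ^ 'n \<Rightarrow> real) \<Rightarrow> real \<Rightarrow> real ^ 'n \<Rightarrow> bool" where
  "has_partial i f D x \<equiv> ((\<lambda>t. f (x + t *\<^sub>R axis i 1)) has_real_derivative D) (at 0)"

text \<open>\<open>deriv\<close> is a choice operator with a value even where no derivative exists,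
  so derivatives are carried as \<open>has_partial\<close> and become equations here.\<close>

lemma partial_eqI: "has_partial i f D x \<Longrightarrow> partial i f x = D"
  unfolding partial_def by (rule DERIV_imp_deriv)

lemma isCont_tendsto_nhds: "isCont f x \<Longrightarrow> (f \<longlongrightarrow> f x) (nhds x)"
  unfolding isCont_def tendsto_at_iff_tendsto_nhds .

text \<open>Closed forms of \<open>partial\<close> are available only where q > 0; equality near the
  point suffices to insert one before differentiating again.\<close>

lemma has_partial_cong:
  assumes "\<forall>\<^sub>F z in nhds x. f z = f' z"
  shows "has_partial i f D x \<longleftrightarrow> has_partial i f' D x"
proof -
  have "((\<lambda>t::real. x + t *\<^sub>R axis i 1) \<longlongrightarrow> x + 0 *\<^sub>R axis i 1) (nhds 0)"
    by (intro tendsto_intros filterlim_ident)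
  then have "filterlim (\<lambda>t::real. x + t *\<^sub>R axis i 1) (nhds x) (nhds 0)"
    by simp
  then have "\<forall>\<^sub>F t in nhds 0. f (x + t *\<^sub>R axis i 1) = f' (x + t *\<^sub>R axis i 1)"
    using assms by (rule eventually_compose_filterlim[rotated])
  then show ?thesis
    by (intro DERIV_cong_ev) auto
qed

lemma has_partial_differentiable:
  assumes "f differentiable (at x)"
  shows "has_partial i f (partial i f x) x"
proof -
  have "(\<lambda>t. x + t *\<^sub>R axis i 1) differentiable (at (0::real))"
    by (intro derivative_intros)
  then have "(f \<circ> (\<lambda>t. x + t *\<^sub>R axis i 1)) differentiable (at (0::real))"
    using assms by (intro differentiable_chain_at) auto
  then show ?thesis
    unfolding partial_def by (simp add: DERIV_deriv_iff_real_differentiable o_def)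
qed

lemma has_partial_linear_coord: "has_partial i (\<lambda>w. w $ j) (if j = i then 1 else 0) y"
  by (auto intro!: derivative_eq_intros simp: axis_def)

lemma has_partial_inner: "has_partial i (\<lambda>w. \<beta> \<bullet> w) (\<beta> $ i) y"
  by (auto intro!: derivative_eq_intros simp: inner_right_distrib inner_axis)

lemma mult_axis_nth: "((A::real^'n^'n) *v axis i 1) $ j = A $ j $ i"
  by (simp add: matrix_vector_mult_basis column_def)

lemma has_partial_matrix_vector: "has_partial i (\<lambda>w. (A *v w) $ j) (A $ j $ i) y"
  for A :: "real^'n^'n"
  by (auto intro!: derivative_eq_intros
      simp: matrix_vector_right_distrib matrix_vector_mult_scaleR mult_axis_nth)

text \<open>The matrix is general so as to cover the Christoffel symbols with fixed upper index
  besides the metric.\<close>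

lemma has_partial_quadratic:
  fixes A :: "real^'n^'n"
  shows "has_partial i (\<lambda>w. w \<bullet> (A *v w)) (((A + transpose A) *v y) $ i) y"
proof -
  have "y \<bullet> (A *v axis i 1) = (transpose A *v y) $ i"
    by (metis dot_lmul_matrix inner_axis inner_real_def mult.right_neutral transpose_matrix_vector)
  then show ?thesis
    by (auto intro!: derivative_eq_intros
        simp: matrix_vector_right_distrib matrix_vector_mult_scaleR inner_axis'
          inner_left_distrib inner_right_distrib matrix_vector_mult_add_rdistrib)
qed

section \<open>The Finsleroid function of \<open>b\<close> and \<open>q\<close>\<close>

text \<open>\<open>Phi_fun\<close> in two real variables, so that one chain rule serves for curves
  in y and curves in x.\<close>

definition angle_bq :: "real \<Rightarrow> real \<Rightarrow> real \<Rightarrow> real" where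
  "angle_bq g b q =
     (if b > 0 then pi / 2 + arctan (G_par g / 2) - arctan ((q + g / 2 * b) / (h_par g * b))
      else if b < 0 then
        - (pi / 2) + arctan (G_par g / 2) - arctan ((q + g / 2 * b) / (h_par g * b))
      else arctan (G_par g / 2))"

definition B_bq :: "real \<Rightarrow> real \<Rightarrow> real \<Rightarrow> real" where
  "B_bq g b q = b\<^sup>2 + g * q * b + q\<^sup>2"

definition J_bq :: "real \<Rightarrow> real \<Rightarrow> real \<Rightarrow> real" where
  "J_bq g b q = exp (G_par g * angle_bq g b q)"

lemma J_bq_pos: "J_bq g b q > 0"
  by (simp add: J_bq_def)

lemma h_par_pos:
  assumes "\<bar>g\<bar> < 2"
  shows "h_par g > 0" and "(h_par g)\<^sup>2 = 1 - g\<^sup>2 / 4"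
proof -
  have "g\<^sup>2 < 2\<^sup>2" using assms by (metis abs_ge_zero power2_abs power_strict_mono zero_less_numeral)
  then show "h_par g > 0" "(h_par g)\<^sup>2 = 1 - g\<^sup>2 / 4" by (auto simp: h_par_def)
qed

text \<open>Completing the square in q with h^2 = 1 - g^2 / 4.\<close>

lemma B_bq_sum_squares:
  assumes "\<bar>g\<bar> < 2"
  shows "B_bq g b q = (h_par g * b)\<^sup>2 + (q + g / 2 * b)\<^sup>2"
  unfolding power_mult_distrib h_par_pos(2)[OF assms]
  by (simp add: B_bq_def power2_eq_square field_simps)

lemma B_bq_nonneg: "\<bar>g\<bar> < 2 \<Longrightarrow> B_bq g b q \<ge> 0"
  by (simp add: B_bq_sum_squares)

lemma B_bq_pos:
  assumes "\<bar>g\<bar> < 2" "q > 0"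
  shows "B_bq g b q > 0"
  using h_par_pos(1)[OF assms(1)] assms(2) B_bq_sum_squares[OF assms(1), of b q]
  by (cases "b = 0") (auto simp: sum_power2_gt_zero_iff)

text \<open>The angle \<open>angle_bq g b q - arctan (G_par g / 2)\<close> is the argument of the point
  with coordinates \<open>q + g b / 2\<close> and \<open>h b\<close>, which stays off the negative axis as
  long as \<open>q > 0\<close>; so the branches of the definition fit together smoothly.\<close>

lemma angle_bq_branch:
  assumes "\<bar>g\<bar> < 2" and "q + g / 2 * b > 0"
  shows "angle_bq g b q = arctan (G_par g / 2) + arctan (h_par g * b / (q + g / 2 * b))"
proof -
  define X where "X = (q + g / 2 * b) / (h_par g * b)"
  have inv: "h_par g * b / (q + g / 2 * b) = 1 / X" by (simp add: X_def)
  note h = h_par_pos(1)[OF assms(1)]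
  consider "b > 0" | "b < 0" | "b = 0" by linarith
  then show ?thesis
  proof cases
    case 1
    then have "X > 0" using assms(2) h by (simp add: X_def)
    then have "arctan (1 / X) = pi / 2 - arctan X"
      by (subst Transcendental.arctan_inverse) simp_all
    then show ?thesis using 1 unfolding inv angle_bq_def X_def[symmetric] by simp
  next
    case 2
    then have "h_par g * b < 0" using h by (simp add: mult_pos_neg)
    then have "X < 0" using assms(2) by (simp add: X_def divide_pos_neg)
    then have "arctan (1 / X) = - (pi / 2) - arctan X"
      by (subst Transcendental.arctan_inverse) simp_all
    then show ?thesis using 2 unfolding inv angle_bq_def X_def[symmetric] by simp
  qed (simp add: angle_bq_def)
qed

text \<open>Up to a constant this is the polar angle of (X, N) with X = q + g b / 2 and N = h b. Its
  derivative is (X N' - N X') / (X^2 + N^2), where the numerator is h (q b' - b q') and the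
  denominator is B.\<close>

lemma angle_bq_deriv:
  assumes g: "\<bar>g\<bar> < 2"
    and b: "(b has_real_derivative b') (at t)"
    and q: "(q has_real_derivative q') (at t)"
    and pos: "q t > 0"
  shows "((\<lambda>t. angle_bq g (b t) (q t)) has_real_derivative
           h_par g * (q t * b' - b t * q') / B_bq g (b t) (q t)) (at t)"
proof -
  note h = h_par_pos(1)[OF g]
  have cont: "isCont b t" "isCont q t" using b q by (auto dest: DERIV_isCont)
  note B = B_bq_pos[OF g pos, of "b t"]
  note Bs = B_bq_sum_squares[OF g, of "b t" "q t"]
  \<comment> \<open>On either side of b = 0 the angle is a constant plus this arctangent.\<close>
  have arc: "((\<lambda>t. - arctan ((q t + g / 2 * b t) / (h_par g * b t))) has_real_derivative
           h_par g * (q t * b' - b t * q') / B_bq g (b t) (q t)) (at t)" if "b t \<noteq> 0"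
  proof -
    define N where "N = h_par g * b t"
    define X where "X = q t + g / 2 * b t"
    have N: "N \<noteq> 0" using that h by (simp add: N_def)
    have "1 + (X / N)\<^sup>2 = B_bq g (b t) (q t) / N\<^sup>2"
      unfolding Bs N_def[symmetric] X_def[symmetric] using N
      by (simp add: power_divide add_divide_distrib)
    then have e: "inverse (1 + (X / N)\<^sup>2) = N\<^sup>2 / B_bq g (b t) (q t)" by simp
    have "((\<lambda>t. (q t + g / 2 * b t) / (h_par g * b t)) has_real_derivative
        ((q' + g / 2 * b') * N - X * (h_par g * b')) / (N * N)) (at t)"
      unfolding N_def X_def using that h
      by (intro DERIV_divide DERIV_add DERIV_cmult b q) simp
    from DERIV_minus[OF DERIV_chain2[OF DERIV_arctan this, folded N_def X_def]]
    have "((\<lambda>t. - arctan ((q t + g / 2 * b t) / (h_par g * b t))) has_real_derivative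
        - (N\<^sup>2 / B_bq g (b t) (q t) * (((q' + g / 2 * b') * N - X * (h_par g * b')) / (N * N))))
        (at t)"
      unfolding N_def[symmetric] X_def[symmetric] e .
    moreover have "- (N\<^sup>2 / B_bq g (b t) (q t) * (E / (N * N))) = - E / B_bq g (b t) (q t)" for E
      using N by (simp add: power2_eq_square)
    moreover have "- ((q' + g / 2 * b') * N - X * (h_par g * b')) = h_par g * (q t * b' - b t * q')"
      by (simp add: N_def X_def algebra_simps)
    ultimately show ?thesis by (simp only:)
  qed
  consider "b t > 0" | "b t < 0" | "b t = 0" by linarith
  then show ?thesis
  proof cases
    case 1
    then have "\<forall>\<^sub>F s in nhds t. b s > 0"
      using cont by (intro order_tendstoD(1)[of b "b t"])
        (auto intro: isCont_tendsto_nhds)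
    then have ev: "\<forall>\<^sub>F s in nhds t. angle_bq g (b s) (q s) =
        (pi / 2 + arctan (G_par g / 2)) + - arctan ((q s + g / 2 * b s) / (h_par g * b s))"
      by eventually_elim (simp add: angle_bq_def)
    show ?thesis
      unfolding DERIV_cong_ev[OF refl ev refl] using DERIV_add[OF DERIV_const arc] 1 by simp
  next
    case 2
    then have "\<forall>\<^sub>F s in nhds t. b s < 0"
      using cont by (intro order_tendstoD(2)[of b "b t"])
        (auto intro: isCont_tendsto_nhds)
    then have ev: "\<forall>\<^sub>F s in nhds t. angle_bq g (b s) (q s) =
        (- (pi / 2) + arctan (G_par g / 2)) + - arctan ((q s + g / 2 * b s) / (h_par g * b s))"
      by eventually_elim (simp add: angle_bq_def)
    show ?thesis
      unfolding DERIV_cong_ev[OF refl ev refl] using DERIV_add[OF DERIV_const arc] 2 by simp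
  next
    case 3
    \<comment> \<open>At b = 0 the case distinction may switch in any neighbourhood.
      \<open>angle_bq_branch\<close> is one formula for all signs of b, valid nearby because q + g b
      / 2 is continuous and here equals q > 0.\<close>
    have "isCont (\<lambda>s. q s + g / 2 * b s) t" using cont by (intro continuous_intros)
    then have "((\<lambda>s. q s + g / 2 * b s) \<longlongrightarrow> q t + g / 2 * b t) (nhds t)"
      by (rule isCont_tendsto_nhds)
    then have "\<forall>\<^sub>F s in nhds t. q s + g / 2 * b s > 0"
      by (rule order_tendstoD(1)) (use 3 pos in simp)
    then have ev: "\<forall>\<^sub>F s in nhds t. angle_bq g (b s) (q s) =
        arctan (G_par g / 2) + arctan (h_par g * b s / (q s + g / 2 * b s))"
      by eventually_elim (rule angle_bq_branch[OF g])
    have "((\<lambda>s. h_par g * b s / (q s + g / 2 * b s)) has_real_derivative h_par g * b' / q t) (at t)"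
      using DERIV_divide[OF DERIV_cmult[OF b, of "h_par g"]
          DERIV_add[OF q DERIV_cmult[OF b, of "g / 2"]]] 3 pos by simp
    from DERIV_add[OF DERIV_const DERIV_chain2[OF DERIV_arctan this]]
    show ?thesis
      unfolding DERIV_cong_ev[OF refl ev refl] using 3 pos
      by (simp add: B_bq_def power2_eq_square)
  qed
qed

section \<open>Derivatives of q, J and K^2 along a curve\<close>

context
  fixes g :: real and b \<sigma> :: "real \<Rightarrow> real" and b' \<sigma>' t q' :: real and q :: "real \<Rightarrow> real"
  assumes g: "\<bar>g\<bar> < 2"
    and b: "(b has_real_derivative b') (at t)"
    and \<sigma>: "(\<sigma> has_real_derivative \<sigma>') (at t)"
    and pos: "\<sigma> t - (b t)\<^sup>2 > 0"
  defines "q \<equiv> \<lambda>t. sqrt (\<sigma> t - (b t)\<^sup>2)"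
    and "q' \<equiv> (\<sigma>' - 2 * b t * b') / (2 * q t)"
begin

text \<open>\<open>\<sigma>\<close> stands for S^2. The parameter may move y at fixed x or x at
  fixed y, so both kinds of derivative come from this context.\<close>

lemma q_deriv: "(q has_real_derivative q') (at t)"
  unfolding q_def q'_def
  by (rule derivative_eq_intros b \<sigma> refl | use pos in simp; fail)+
    (use pos in \<open>simp add: field_simps\<close>)

text \<open>The factor h in the derivative of the angle cancels the denominator of G = g /
  h.\<close>

lemma J_deriv:
  "((\<lambda>t. J_bq g (b t) (q t)) has_real_derivative
      g * J_bq g (b t) (q t) * (q t * b' - b t * q') / B_bq g (b t) (q t)) (at t)"
proof -
  have "q t > 0" using pos by (simp add: q_def)
  note d = angle_bq_deriv[OF g b q_deriv this]
  show ?thesis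
    unfolding J_bq_def
    by (rule derivative_eq_intros d refl)+
      (use h_par_pos(1)[OF g] in \<open>simp add: G_par_def\<close>)
qed

text \<open>Here B' = (2 b + g q) b' + (2 q + g b) q' and B J' = g J (q b' - b q'). In J B' + B J'
  the terms in g b q' cancel, and 2 b b' + 2 q q' is the derivative of b^2 + q^2 =
  \<open>\<sigma>\<close>.\<close>

lemma F_deriv:
  "((\<lambda>t. B_bq g (b t) (q t) * J_bq g (b t) (q t)) has_real_derivative
      J_bq g (b t) (q t) * (2 * g * q t * b' + \<sigma>')) (at t)"
proof -
  have q: "q t > 0" using pos by (simp add: q_def)
  note B = B_bq_pos[OF g q, of "b t"]
  have \<sigma>': "\<sigma>' = 2 * q t * q' + 2 * b t * b'" using q by (simp add: q'_def)
  have "((\<lambda>t. B_bq g (b t) (q t)) has_real_derivative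
      2 * b t * b' + g * q' * b t + g * q t * b' + 2 * q t * q') (at t)"
    unfolding B_bq_def
    by (rule derivative_eq_intros b q_deriv refl)+ (simp add: algebra_simps)
  from DERIV_mult[OF this J_deriv] show ?thesis
    by (rule DERIV_cong) (use B in \<open>simp add: \<sigma>' field_simps\<close>)
qed

end


section \<open>The metric at one point\<close>

lemma matrix_inv_inverse:
  assumes "invertible A"
  shows "A ** matrix_inv A = mat 1" and "matrix_inv A ** A = mat 1"
  using someI_ex[OF assms[unfolded invertible_def]] by (simp_all add: matrix_inv_def)

lemma posdef_invertible:
  fixes A :: "real^'n^'n"
  assumes "\<And>y. y \<noteq> 0 \<Longrightarrow> y \<bullet> (A *v y) > 0"
  shows "invertible A"
proof -
  have "x = 0" if "A *v x = 0" for x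
    using assms[of x] that by (cases "x = 0") auto
  then show ?thesis
    unfolding invertible_left_inverse matrix_left_invertible_ker by auto
qed

lemma symmetric_inner:
  fixes A :: "real^'n^'n"
  assumes "transpose A = A"
  shows "x \<bullet> (A *v y) = y \<bullet> (A *v x)"
  by (metis assms dot_lmul_matrix inner_commute transpose_matrix_vector)

lemma matrix_quadratic_sum:
  fixes A :: "real^'n^'n"
  shows "y \<bullet> (A *v y) = (\<Sum>i\<in>UNIV. \<Sum>j\<in>UNIV. A $ i $ j * y $ i * y $ j)"
  by (simp add: inner_vec_def matrix_vector_mult_def sum_distrib_left mult_ac)

lemma b_val_eq: "b_val \<beta> y = \<beta> \<bullet> y"
  by (simp add: b_val_def inner_vec_def)

lemma b_up_eq: "b_up A \<beta> = matrix_inv A *v \<beta>"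
  by (simp add: b_up_def matrix_vector_mult_def)

lemma v_up_eq: "v_up A \<beta> y = y - (\<beta> \<bullet> y) *\<^sub>R b_up A \<beta>"
  by (simp add: v_up_def b_val_eq vec_eq_iff)

lemma v_low_eq_mult: "v_low A \<beta> y = A *v v_up A \<beta> y"
  by (simp add: v_low_def matrix_vector_mult_def)

text \<open>The radicand of q. Writing q \<noteq> 0 as \<open>q_sq A \<beta> y > 0\<close> gives an
  open condition under which the root is differentiable.\<close>

definition q_sq :: "real ^ 'n ^ 'n \<Rightarrow> real ^ 'n \<Rightarrow> real ^ 'n \<Rightarrow> real" where
  "q_sq A \<beta> y = y \<bullet> (A *v y) - (\<beta> \<bullet> y)\<^sup>2"

lemma q_val_eq: "q_val A \<beta> y = sqrt (q_sq A \<beta> y)"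
proof -
  have "(\<beta> \<bullet> y)\<^sup>2 = (\<Sum>i\<in>UNIV. \<Sum>j\<in>UNIV. (\<beta> $ i * \<beta> $ j) * y $ i * y $ j)"
    by (simp add: inner_vec_def power2_eq_square sum_product mult_ac)
  then show ?thesis
    by (simp add: q_val_def r_low_def q_sq_def matrix_quadratic_sum
        left_diff_distrib sum_subtractf)
qed

lemma continuous_q_sq: "isCont (q_sq A \<beta>) y"
  unfolding q_sq_def[abs_def] by (intro continuous_intros matrix_vector_mult_linear_continuous_at)

lemma eventually_q_sq_pos:
  assumes "q_sq A \<beta> y > 0"
  shows "\<forall>\<^sub>F w in nhds y. q_sq A \<beta> w > 0"
  using order_tendstoD(1)[OF isCont_tendsto_nhds[OF continuous_q_sq] assms] .

text \<open>The covector g_ij y^j, equivalently half the y-gradient of K^2.\<close>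

definition finsleroid_covector ::
  "real \<Rightarrow> real ^ 'n ^ 'n \<Rightarrow> real ^ 'n \<Rightarrow> real ^ 'n \<Rightarrow> real ^ 'n" where
  "finsleroid_covector g A \<beta> y =
     J_bq g (\<beta> \<bullet> y) (q_val A \<beta> y) *\<^sub>R (A *v y + (g * q_val A \<beta> y) *\<^sub>R \<beta>)"

text \<open>The closed form of g_ij: J times the sum of a_ij and symmetric products of b_i and
  \<open>u\<close>, which is v_i when a_ij is positive definite.\<close>

definition finsleroid_matrix ::
  "real \<Rightarrow> real ^ 'n ^ 'n \<Rightarrow> real ^ 'n \<Rightarrow> real ^ 'n \<Rightarrow> real ^ 'n ^ 'n" where
  "finsleroid_matrix g A \<beta> y =
     (let b = \<beta> \<bullet> y; q = q_val A \<beta> y; u = A *v y - (\<beta> \<bullet> y) *\<^sub>R \<beta>; B = B_bq g b q in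
      \<chi> i j. J_bq g b q * (A $ i $ j + g * q / B * (u $ i * \<beta> $ j + \<beta> $ i * u $ j) +
        g * q * (b + g * q) / B * \<beta> $ i * \<beta> $ j - g * b / (q * B) * u $ i * u $ j))"

text \<open>General coefficients let the sums over \<open>j\<close> collapse to inner products
  before the actual ones enter.\<close>

lemma rank_two_update_mult:
  fixes A :: "real^'n^'n"
  shows "((\<chi> i j. J * (A $ i $ j + c * (u $ i * \<beta> $ j + \<beta> $ i * u $ j) +
      d * \<beta> $ i * \<beta> $ j - e * u $ i * u $ j)) *v w) $ i =
    J * ((A *v w) $ i + c * (u $ i * (\<beta> \<bullet> w) + \<beta> $ i * (u \<bullet> w)) +
      d * \<beta> $ i * (\<beta> \<bullet> w) - e * u $ i * (u \<bullet> w))"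
proof -
  have "(J * (A $ i $ j + c * (u $ i * \<beta> $ j + \<beta> $ i * u $ j) +
      d * \<beta> $ i * \<beta> $ j - e * u $ i * u $ j)) * w $ j =
      J * (A $ i $ j * w $ j) + J * c * u $ i * (\<beta> $ j * w $ j) + J * c * \<beta> $ i * (u $ j * w $ j)
      + J * d * \<beta> $ i * (\<beta> $ j * w $ j) - J * e * u $ i * (u $ j * w $ j)" for j
    by (simp add: algebra_simps)
  then show ?thesis
    by (simp add: matrix_vector_mult_def inner_vec_def sum.distrib sum_subtractf
        flip: sum_distrib_left) (simp add: algebra_simps)
qed

section \<open>Algebra and positivity at a fixed base point\<close>

locale finsleroid_point =
  fixes A :: "real ^ 'n::finite ^ 'n" and \<beta> :: "real ^ 'n" and g :: real
  assumes sym: "transpose A = A"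
    and pos: "\<And>y. y \<noteq> 0 \<Longrightarrow> y \<bullet> (A *v y) > 0"
    and unit: "covector_norm_sq A \<beta> = 1"
    and g: "\<bar>g\<bar> < 2"
begin

abbreviation "b y \<equiv> \<beta> \<bullet> y"
abbreviation "q \<equiv> q_val A \<beta>"
abbreviation "u \<equiv> v_low A \<beta>"
abbreviation "v \<equiv> v_up A \<beta>"
abbreviation "B y \<equiv> B_bq g (b y) (q y)"
abbreviation "J y \<equiv> J_bq g (b y) (q y)"

lemma sym_nth: "A $ i $ j = A $ j $ i"
  by (metis sym transpose_def vec_lambda_beta)

lemma A_b_up: "A *v b_up A \<beta> = \<beta>"
  by (simp add: b_up_eq matrix_vector_mul_assoc matrix_inv_inverse posdef_invertible pos)

lemma b_b_up: "b (b_up A \<beta>) = 1"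
  using unit
  by (simp add: covector_norm_sq_def b_up_def inner_vec_def sum_distrib_left mult_ac)

lemma u_eq: "u y = A *v y - b y *\<^sub>R \<beta>"
  by (simp add: v_low_eq_mult v_up_eq matrix_vector_mult_diff_distrib
      matrix_vector_mult_scaleR A_b_up)

lemma b_v: "b (v y) = 0"
  by (simp add: v_up_eq inner_diff_right b_b_up)

lemma u_inner: "u y \<bullet> w = y \<bullet> (A *v w) - b y * b w"
  by (simp add: u_eq inner_diff_left symmetric_inner[OF sym] inner_commute[of "A *v y"])

lemma u_self: "u y \<bullet> y = q_sq A \<beta> y"
  by (simp add: u_inner q_sq_def power2_eq_square)

text \<open>The covector \<open>u y\<close> annihilates b^i, because b has unit length.\<close>

lemma u_v: "u y \<bullet> v y = q_sq A \<beta> y"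
proof -
  have "u y \<bullet> b_up A \<beta> = 0"
    using inner_commute[of y \<beta>] by (simp add: u_inner A_b_up b_b_up)
  then show ?thesis by (simp add: v_up_eq inner_diff_right u_self)
qed

text \<open>q is the Riemannian length of v.\<close>

lemma q_sq_nonneg: "q_sq A \<beta> y \<ge> 0"
proof -
  have "q_sq A \<beta> y = v y \<bullet> (A *v v y)"
    by (simp add: inner_commute v_low_eq_mult flip: u_v)
  also have "\<dots> \<ge> 0" using pos[of "v y"] by (cases "v y = 0") auto
  finally show ?thesis .
qed

lemma q_pos_iff: "q_sq A \<beta> y > 0 \<longleftrightarrow> q y \<noteq> 0"
  using q_sq_nonneg[of y] by (auto simp: q_val_eq)

lemma q_square: "(q y)\<^sup>2 = q_sq A \<beta> y"
  using q_sq_nonneg[of y] by (simp add: q_val_eq)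

text \<open>Cauchy-Schwarz for the semidefinite form r_ij: its value at w - c y is nonnegative, with
  \<open>c\<close> chosen to minimise that value.\<close>

lemma q_sq_Cauchy_Schwarz:
  assumes "q_sq A \<beta> y > 0"
  shows "(u y \<bullet> w)\<^sup>2 / q_sq A \<beta> y \<le> q_sq A \<beta> w"
proof -
  define c where "c = (u y \<bullet> w) / q_sq A \<beta> y"
  have "q_sq A \<beta> (w - c *\<^sub>R y) = q_sq A \<beta> w - 2 * c * (u y \<bullet> w) + c\<^sup>2 * q_sq A \<beta> y"
    unfolding q_sq_def u_inner
    by (simp add: matrix_vector_mult_diff_distrib matrix_vector_mult_scaleR inner_diff_left
        inner_diff_right symmetric_inner[OF sym, of w y] power2_eq_square algebra_simps)
  also have "\<dots> = q_sq A \<beta> w - (u y \<bullet> w)\<^sup>2 / q_sq A \<beta> y"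
    using assms by (simp add: c_def field_simps power2_eq_square)
  finally show ?thesis using q_sq_nonneg[of "w - c *\<^sub>R y"] by simp
qed

lemma finsleroid_square: "(finsleroid g A \<beta> y)\<^sup>2 = B y * J y"
proof -
  have "B_fun g A \<beta> y = B y" by (simp add: B_fun_def B_bq_def b_val_eq)
  moreover have "Phi_fun g A \<beta> y = angle_bq g (b y) (q y)"
    by (simp add: Phi_fun_def angle_bq_def b_val_eq Let_def)
  moreover have "(exp (1 / 2 * t))\<^sup>2 = exp t" for t :: real
    by (simp flip: exp_of_nat_mult)
  ultimately show ?thesis
    using B_bq_nonneg[OF g] exp_double[of "1 / 2 * (G_par g * angle_bq g (b y) (q y))"]
    by (simp add: finsleroid_def J_bq_def power_mult_distrib mult.assoc)
qed

text \<open>Euler's identity for a function of degree two; it comes from y^i a_ij y^j = b^2 +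
  q^2.\<close>

lemma covector_self: "y \<bullet> finsleroid_covector g A \<beta> y = B y * J y"
proof -
  have "y \<bullet> (A *v y) = (b y)\<^sup>2 + (q y)\<^sup>2"
    by (simp add: q_square q_sq_def)
  then show ?thesis
    by (simp add: finsleroid_covector_def B_bq_def inner_add_right inner_commute[of y \<beta>]
        algebra_simps)
qed

text \<open>The derivative of \<open>finsleroid_covector\<close> in the direction w:
  \<open>b w\<close> and \<open>(u y \<bullet> w) / q y\<close> are the derivatives of b and q, the
  first summand differentiates J and the second the vector factor. In this form it can be compared
  with x-derivatives.\<close>

lemma matrix_mult:
  assumes "q_sq A \<beta> y > 0"
  shows "(finsleroid_matrix g A \<beta> y *v w) $ i =
    g * J y * (q y * b w - b y * ((u y \<bullet> w) / q y)) / B y * ((A *v y) $ i + g * q y * \<beta> $ i) +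
    J y * ((A *v w) $ i + g * \<beta> $ i * ((u y \<bullet> w) / q y))"
proof -
  have q: "q y > 0" using assms by (simp add: q_val_eq)
  note B = B_bq_pos[OF g q, of "b y"]
  have Ay: "(A *v y) $ i = u y $ i + b y * \<beta> $ i" by (simp add: u_eq)
  have e: "g * \<beta> $ i * ((u y \<bullet> w) / q y) = g * \<beta> $ i * ((u y \<bullet> w) / q y) * B y / B y"
    using B by simp
  show ?thesis
    unfolding finsleroid_matrix_def Let_def u_eq[symmetric] rank_two_update_mult Ay
    using q B
    by (subst e) (simp add: divide_simps, simp add: B_bq_def power2_eq_square algebra_simps)
qed

text \<open>For w = y the derivative of q is q itself, so q b - b q = 0 removes the first summand of
  \<open>matrix_mult\<close>.\<close>

lemma matrix_mult_self:
  assumes "q_sq A \<beta> y > 0"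
  shows "finsleroid_matrix g A \<beta> y *v y = finsleroid_covector g A \<beta> y"
proof -
  have "(u y \<bullet> y) / q y = q y"
    using assms by (simp add: u_self q_val_eq real_div_sqrt)
  then show ?thesis
    unfolding vec_eq_iff matrix_mult[OF assms]
    by (simp add: finsleroid_covector_def algebra_simps)
qed

text \<open>The value is a quadratic form in \<open>b w\<close> and \<open>\<tau>\<close>, the
  derivative of q along w, plus a Cauchy-Schwarz remainder. Completing the square in
  \<open>\<tau>\<close> shows that no term is negative.\<close>

lemma matrix_posdef:
  assumes "q_sq A \<beta> y > 0" and "w \<noteq> 0"
  shows "w \<bullet> (finsleroid_matrix g A \<beta> y *v w) > 0"
proof -
  have q: "q y > 0" using assms by (simp add: q_val_eq)
  define \<tau> where "\<tau> = (u y \<bullet> w) / q y"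
  \<comment> \<open>\<open>P\<close> is S^2; the coefficient of \<tau>^2 becomes \<open>P\<close>
    after multiplication by B / J.\<close>
  define P where "P = (b y)\<^sup>2 + (q y)\<^sup>2"
  note B = B_bq_pos[OF g q, of "b y"]
  have P: "P > 0" using q by (simp add: P_def add_nonneg_pos)
  have uw: "u y \<bullet> w = q y * \<tau>" using q by (simp add: \<tau>_def)
  have ww: "w \<bullet> (A *v w) = q_sq A \<beta> w + (b w)\<^sup>2" by (simp add: q_sq_def)
  have yw: "w \<bullet> (A *v y) = q y * \<tau> + b y * b w"
    unfolding uw[symmetric] u_inner by (simp add: symmetric_inner[OF sym])
  have cs: "\<tau>\<^sup>2 \<le> q_sq A \<beta> w"
    using q_sq_Cauchy_Schwarz[OF assms(1), of w] q by (simp add: uw power_mult_distrib flip: q_square)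
  have "w \<bullet> (finsleroid_matrix g A \<beta> y *v w) =
     g * J y * (q y * b w - b y * \<tau>) / B y * (w \<bullet> (A *v y) + g * q y * b w) +
     J y * (w \<bullet> (A *v w) + g * b w * \<tau>)"
  proof -
    define c where "c = g * J y * (q y * b w - b y * \<tau>) / B y"
    have "finsleroid_matrix g A \<beta> y *v w =
       c *\<^sub>R (A *v y + (g * q y) *\<^sub>R \<beta>) + J y *\<^sub>R (A *v w + (g * \<tau>) *\<^sub>R \<beta>)"
      unfolding vec_eq_iff matrix_mult[OF assms(1), where w = w, folded \<tau>_def, folded c_def] by (simp add: algebra_simps)
    then show ?thesis unfolding c_def[symmetric]
      by (simp add: inner_add_right inner_commute[of w \<beta>] algebra_simps)
  qed
  text \<open>The discriminant works out because \<open>P ((b + g q)\<^sup>2 + q\<^sup>2) - (g q\<^sup>2)\<^sup>2 = B\<^sup>2\<close>.\<close>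
  also have "\<dots> = J y / (B y * P) *
      (B y * P * (q_sq A \<beta> w - \<tau>\<^sup>2) + (P * \<tau> + g * (q y)\<^sup>2 * b w)\<^sup>2 + (B y)\<^sup>2 * (b w)\<^sup>2)"
    unfolding yw ww using B P
    by (simp add: divide_simps) (simp add: P_def B_bq_def power2_eq_square algebra_simps)
  also have "\<dots> > 0"
  proof -
    have "B y * P * (q_sq A \<beta> w - \<tau>\<^sup>2) + (P * \<tau> + g * (q y)\<^sup>2 * b w)\<^sup>2 + (B y)\<^sup>2 * (b w)\<^sup>2 > 0"
    \<comment> \<open>If both vanish, positivity of a_ij at w decides; otherwise one of the last two
      squares is positive.\<close>
    proof (cases "b w = 0 \<and> \<tau> = 0")
      case True
      then show ?thesis using ww pos[OF assms(2)] B P by simp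
    next
      case False
      then have "(P * \<tau> + g * (q y)\<^sup>2 * b w)\<^sup>2 + (B y * b w)\<^sup>2 > 0"
        using B P by (cases "b w = 0") (auto simp: sum_power2_gt_zero_iff)
      then show ?thesis using B P cs
        by (simp add: power_mult_distrib add_nonneg_pos add.assoc)
    qed
    then show ?thesis using B P J_bq_pos[of g "b y" "q y"] by simp
  qed
  finally show ?thesis .
qed

lemma matrix_inverse_mult:
  assumes "q_sq A \<beta> y > 0"
  shows "matrix_inv (finsleroid_matrix g A \<beta> y) *v (finsleroid_matrix g A \<beta> y *v w) = w"
  by (simp add: matrix_vector_mul_assoc matrix_inv_inverse posdef_invertible matrix_posdef[OF assms])

section \<open>First and second y-derivatives of K^2\<close>

lemma has_partial_quadratic_sym: "has_partial i (\<lambda>w. w \<bullet> (A *v w)) (2 * (A *v y) $ i) y"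
  using has_partial_quadratic[where i = i and A = A and y = y]
  unfolding sym matrix_vector_mult_add_rdistrib by simp

lemma has_partial_q:
  assumes "q_sq A \<beta> y > 0"
  shows "has_partial i q (u y $ i / q y) y"
  using q_deriv[OF g has_partial_inner[where i = i and \<beta> = \<beta> and y = y]
      has_partial_quadratic_sym[where i = i and y = y]] assms
  unfolding q_val_eq[abs_def] q_sq_def[abs_def] by (simp add: u_eq diff_divide_distrib)

lemma has_partial_J:
  assumes "q_sq A \<beta> y > 0"
  shows "has_partial i J (g * J y * (q y * \<beta> $ i - b y * (u y $ i / q y)) / B y) y"
  using J_deriv[OF g has_partial_inner[where i = i and \<beta> = \<beta> and y = y]
      has_partial_quadratic_sym[where i = i and y = y]] assms
  unfolding q_val_eq[abs_def] q_sq_def[abs_def] by (simp add: u_eq diff_divide_distrib)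

lemma has_partial_finsleroid_square:
  assumes "q_sq A \<beta> y > 0"
  shows "has_partial i (\<lambda>w. (finsleroid g A \<beta> w)\<^sup>2) (2 * finsleroid_covector g A \<beta> y $ i) y"
  using F_deriv[OF g has_partial_inner[where i = i and \<beta> = \<beta> and y = y]
      has_partial_quadratic_sym[where i = i and y = y]] assms
  unfolding finsleroid_square
  unfolding q_val_eq[abs_def] q_sq_def[abs_def] finsleroid_covector_def by (simp add: algebra_simps)

text \<open>The matrix is symmetric, so its entry is a component of \<open>matrix_mult\<close> at a
  basis vector, and that is the product rule for the covector.\<close>

lemma has_partial_covector:
  assumes "q_sq A \<beta> y > 0"
  shows "has_partial i (\<lambda>w. finsleroid_covector g A \<beta> w $ j) (finsleroid_matrix g A \<beta> y $ i $ j) y"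
proof -
  have q: "q y > 0" using assms by (simp add: q_val_eq)
  note B = B_bq_pos[OF g q, of "b y"]
  have "finsleroid_matrix g A \<beta> y $ i $ j = (finsleroid_matrix g A \<beta> y *v axis i 1) $ j"
    by (simp add: mult_axis_nth finsleroid_matrix_def Let_def sym_nth[of i j] algebra_simps)
  also have "\<dots> = g * J y * (q y * \<beta> $ i - b y * (u y $ i / q y)) / B y *
      ((A *v y) $ j + g * q y * \<beta> $ j) + J y * (A $ j $ i + g * \<beta> $ j * (u y $ i / q y))"
    unfolding matrix_mult[OF assms] by (simp add: inner_axis mult_axis_nth)
  finally have m: "finsleroid_matrix g A \<beta> y $ i $ j = \<dots>" .
  show ?thesis
    unfolding m finsleroid_covector_def vector_scaleR_component
      vector_add_component real_scaleR_def
    by (rule derivative_eq_intros has_partial_J[OF assms] has_partial_q[OF assms]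
        has_partial_matrix_vector refl)+ (simp add: algebra_simps)
qed

text \<open>The condition q > 0 is open, so near y the first derivative may be replaced by the
  covector before the second is taken.\<close>

lemma half_hessian:
  assumes "q_sq A \<beta> y > 0"
  shows "(\<chi> i j. 1 / 2 * partial i (partial j (\<lambda>w. (finsleroid g A \<beta> w)\<^sup>2)) y) =
    finsleroid_matrix g A \<beta> y"
proof -
  have "partial i (partial j (\<lambda>w. (finsleroid g A \<beta> w)\<^sup>2)) y = 2 * finsleroid_matrix g A \<beta> y $ i $ j"
    for i j
  proof (rule partial_eqI)
    have ev: "\<forall>\<^sub>F w in nhds y. partial j (\<lambda>w. (finsleroid g A \<beta> w)\<^sup>2) w =
        2 * finsleroid_covector g A \<beta> w $ j"
      using eventually_q_sq_pos[OF assms]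
      by eventually_elim (rule partial_eqI[OF has_partial_finsleroid_square])
    show "has_partial i (partial j (\<lambda>w. (finsleroid g A \<beta> w)\<^sup>2))
        (2 * finsleroid_matrix g A \<beta> y $ i $ j) y"
      unfolding has_partial_cong[OF ev] by (intro DERIV_cmult has_partial_covector assms)
  qed
  then show ?thesis by (simp add: vec_eq_iff)
qed

section \<open>Third y-derivatives of a spray of Landsberg type\<close>

lemma has_partial_u: "has_partial i (\<lambda>w. u w $ j) (r_low A \<beta> j i) y"
  unfolding u_eq vector_minus_component vector_scaleR_component real_scaleR_def
  by (rule derivative_eq_intros has_partial_matrix_vector has_partial_inner refl)+
    (simp add: r_low_def)

lemma has_partial_v: "has_partial i (\<lambda>w. v w $ j) (r_mix A \<beta> j i) y"
  unfolding v_up_eq vector_minus_component vector_scaleR_component real_scaleR_def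
  by (rule derivative_eq_intros has_partial_linear_coord has_partial_inner refl)+
    (simp add: r_mix_def)

text \<open>The third derivatives of the quadratic part vanish. Those of q v^i follow from the
  derivative v_j / q of q, since v^i and v_j are linear in y with derivatives \<open>r_mix\<close>
  and \<open>r_low\<close>.\<close>

lemma partial3_spray:
  fixes \<Gamma> :: "real^'n^'n"
  assumes y: "q_sq A \<beta> y > 0"
    and H: "\<And>w. q_sq A \<beta> w > 0 \<Longrightarrow> H w = c * q w * v w $ i + w \<bullet> (\<Gamma> *v w)"
  shows "partial l (partial m (partial n H)) y =
    c / q y * (eta_mix A \<beta> y i l * eta_low A \<beta> y m n + eta_mix A \<beta> y i m * eta_low A \<beta> y l n +
      eta_mix A \<beta> y i n * eta_low A \<beta> y l m)"
proof -
  let ?\<Gamma> = "\<Gamma> + transpose \<Gamma>"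
  have 1: "partial n H w = c * (u w $ n / q w * v w $ i + q w * r_mix A \<beta> i n) + (?\<Gamma> *v w) $ n"
    if "q_sq A \<beta> w > 0" for w
  proof (rule partial_eqI)
    have ev: "\<forall>\<^sub>F w in nhds w. H w = c * q w * v w $ i + w \<bullet> (\<Gamma> *v w)"
      using eventually_q_sq_pos[OF that] by eventually_elim (rule H)
    show "has_partial n H
        (c * (u w $ n / q w * v w $ i + q w * r_mix A \<beta> i n) + (?\<Gamma> *v w) $ n) w"
      unfolding has_partial_cong[OF ev]
      by (rule derivative_eq_intros has_partial_q[OF that] has_partial_v
          has_partial_quadratic refl)+ (simp add: algebra_simps)
  qed
  \<comment> \<open>\<open>eta_low\<close> enters as q times the y-Hessian of q.\<close>
  have 2: "partial m (partial n H) w =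
      c * (eta_low A \<beta> w n m / q w * v w $ i + u w $ n / q w * r_mix A \<beta> i m +
        u w $ m / q w * r_mix A \<beta> i n) + ?\<Gamma> $ n $ m"
    if s: "q_sq A \<beta> w > 0" for w
  proof (rule partial_eqI)
    have ev: "\<forall>\<^sub>F w in nhds w. partial n H w =
        c * (u w $ n / q w * v w $ i + q w * r_mix A \<beta> i n) + (?\<Gamma> *v w) $ n"
      using eventually_q_sq_pos[OF that] by eventually_elim (rule 1)
    have q: "q w \<noteq> 0" using s by (simp add: q_pos_iff)
    show "has_partial m (partial n H)
        (c * (eta_low A \<beta> w n m / q w * v w $ i + u w $ n / q w * r_mix A \<beta> i m +
        u w $ m / q w * r_mix A \<beta> i n) + ?\<Gamma> $ n $ m) w"
      unfolding has_partial_cong[OF ev]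
      by (rule derivative_eq_intros has_partial_q[OF s] has_partial_v has_partial_u
          has_partial_matrix_vector refl | use q in simp; fail)+
        (use q in \<open>simp add: eta_low_def field_simps power2_eq_square\<close>)
  qed
  show ?thesis
  proof (rule partial_eqI)
    \<comment> \<open>\<open>eta_low\<close> is expanded because the derivative rules at hand are
      those for \<open>q\<close>, \<open>u\<close> and \<open>v\<close>.\<close>
    have ev: "\<forall>\<^sub>F w in nhds y. partial m (partial n H) w =
        c * ((r_low A \<beta> n m - 1 / (q w)\<^sup>2 * u w $ n * u w $ m) / q w * v w $ i +
          u w $ n / q w * r_mix A \<beta> i m + u w $ m / q w * r_mix A \<beta> i n) + ?\<Gamma> $ n $ m"
      using eventually_q_sq_pos[OF y] by eventually_elim (simp add: 2 eta_low_def)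
    have q: "q y \<noteq> 0" using y by (simp add: q_pos_iff)
    have rs: "r_low A \<beta> m n = r_low A \<beta> n m" "r_low A \<beta> l n = r_low A \<beta> n l"
      "r_low A \<beta> l m = r_low A \<beta> m l"
      by (simp_all add: r_low_def sym_nth[of m n] sym_nth[of l n] sym_nth[of l m] mult.commute)
    show "has_partial l (partial m (partial n H))
        (c / q y * (eta_mix A \<beta> y i l * eta_low A \<beta> y m n + eta_mix A \<beta> y i m * eta_low A \<beta> y l n +
      eta_mix A \<beta> y i n * eta_low A \<beta> y l m)) y"
      unfolding has_partial_cong[OF ev]
      by (rule derivative_eq_intros has_partial_q[OF y] has_partial_v has_partial_u
          refl | use q in simp; fail)+
        (use q in \<open>simp add: eta_low_def eta_mix_def rs field_simps power2_eq_square\<close>)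
  qed
qed

end

section \<open>The spray in one chart\<close>

text \<open>Applied both to \<open>a\<close> and to the Finslerian metric with \<open>y\<close> held fixed.\<close>

lemma christoffel_contract:
  fixes h :: "real ^ 'n \<Rightarrow> real ^ 'n ^ 'n"
  shows "(\<chi> i. \<Sum>n\<in>UNIV. \<Sum>m\<in>UNIV. christoffel h x i n m * y $ n * y $ m) =
    matrix_inv (h x) *v (\<chi> l. (\<Sum>j\<in>UNIV. y $ j * (\<Sum>n\<in>UNIV. partial j (\<lambda>z. h z $ l $ n) x * y $ n)) -
      1 / 2 * (\<Sum>m\<in>UNIV. \<Sum>n\<in>UNIV. partial l (\<lambda>z. h z $ m $ n) x * y $ m * y $ n))"
proof -
  define d where "d = (\<lambda>m l n. partial m (\<lambda>z. h z $ l $ n) x)"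
  \<comment> \<open>Renaming indices makes the first two derivative terms of the Christoffel symbol
    equal after contraction with y twice.\<close>
  have R: "(\<Sum>n\<in>UNIV. \<Sum>m\<in>UNIV. (d m l n + d n l m - d l m n) * y $ n * y $ m) =
      2 * (\<Sum>j\<in>UNIV. y $ j * (\<Sum>n\<in>UNIV. d j l n * y $ n)) -
      (\<Sum>m\<in>UNIV. \<Sum>n\<in>UNIV. d l m n * y $ m * y $ n)" for l
  proof -
    have "(\<Sum>n\<in>UNIV. \<Sum>m\<in>UNIV. d m l n * y $ n * y $ m) =
        (\<Sum>j\<in>UNIV. y $ j * (\<Sum>n\<in>UNIV. d j l n * y $ n))"
      by (subst sum.swap) (simp add: sum_distrib_left mult_ac)
    moreover have "(\<Sum>n\<in>UNIV. \<Sum>m\<in>UNIV. d n l m * y $ n * y $ m) =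
        (\<Sum>j\<in>UNIV. y $ j * (\<Sum>n\<in>UNIV. d j l n * y $ n))"
      by (simp add: sum_distrib_left mult_ac)
    moreover have "(\<Sum>n\<in>UNIV. \<Sum>m\<in>UNIV. d l m n * y $ n * y $ m) =
        (\<Sum>m\<in>UNIV. \<Sum>n\<in>UNIV. d l m n * y $ m * y $ n)"
      by (subst sum.swap) (simp add: mult_ac)
    ultimately show ?thesis
      by (simp add: distrib_right left_diff_distrib sum.distrib sum_subtractf)
  qed
  have "(\<Sum>n\<in>UNIV. \<Sum>m\<in>UNIV. christoffel h x i n m * y $ n * y $ m) =
      (\<Sum>l\<in>UNIV. matrix_inv (h x) $ i $ l * (1 / 2 *
        (\<Sum>n\<in>UNIV. \<Sum>m\<in>UNIV. (d m l n + d n l m - d l m n) * y $ n * y $ m)))" for i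
  proof -
    have "(\<Sum>n\<in>UNIV. \<Sum>m\<in>UNIV. christoffel h x i n m * y $ n * y $ m) =
      (\<Sum>n\<in>UNIV. \<Sum>m\<in>UNIV. \<Sum>l\<in>UNIV. matrix_inv (h x) $ i $ l * (1 / 2 *
        ((d m l n + d n l m - d l m n) * y $ n * y $ m)))"
      by (simp add: christoffel_def d_def sum_distrib_left sum_distrib_right mult_ac)
    also have "\<dots> = (\<Sum>n\<in>UNIV. \<Sum>l\<in>UNIV. \<Sum>m\<in>UNIV. matrix_inv (h x) $ i $ l * (1 / 2 *
        ((d m l n + d n l m - d l m n) * y $ n * y $ m)))"
      by (rule sum.cong[OF refl], rule sum.swap)
    also have "\<dots> = (\<Sum>l\<in>UNIV. \<Sum>n\<in>UNIV. \<Sum>m\<in>UNIV. matrix_inv (h x) $ i $ l * (1 / 2 *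
        ((d m l n + d n l m - d l m n) * y $ n * y $ m)))"
      by (rule sum.swap)
    finally show ?thesis by (simp add: sum_distrib_left)
  qed
  then show ?thesis
    unfolding R by (simp add: vec_eq_iff matrix_vector_mult_def right_diff_distrib d_def)
qed

text \<open>One point of one chart, with \<kappa> the value of k there. The algebraic conditions
  hold near \<open>x\<close>, so that their consequences can be differentiated in x; the condition
  on the covariant derivative enters at \<open>x\<close> alone.\<close>

locale finsleroid_field =
  fixes a :: "real ^ 'n::finite \<Rightarrow> real ^ 'n ^ 'n" and b :: "real ^ 'n \<Rightarrow> real ^ 'n"
    and g :: real and x :: "real ^ 'n" and \<kappa> :: real
  assumes eventually_point: "\<forall>\<^sub>F z in nhds x. finsleroid_point (a z) (b z) g"
    and a_differentiable: "(\<lambda>z. a z $ i $ j) differentiable (at x)"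
    and b_differentiable: "(\<lambda>z. b z $ i) differentiable (at x)"
    and cov: "cov_deriv a b x j i = \<kappa> * (a x $ i $ j - b x $ i * b x $ j)"
begin

sublocale finsleroid_point "a x" "b x" g
  using eventually_nhds_x_imp_x[OF eventually_point] .

section \<open>Derivatives of a and b, and the Riemannian spray\<close>

definition Da :: "'n \<Rightarrow> real ^ 'n ^ 'n" where
  "Da j = (\<chi> i k. partial j (\<lambda>z. a z $ i $ k) x)"

definition Db :: "'n \<Rightarrow> real ^ 'n" where
  "Db j = (\<chi> i. partial j (\<lambda>z. b z $ i) x)"

lemma has_partial_a: "has_partial j (\<lambda>z. a z $ i $ k) (Da j $ i $ k) x"
  unfolding Da_def vec_lambda_beta by (rule has_partial_differentiable[OF a_differentiable])

lemma has_partial_b: "has_partial j (\<lambda>z. b z $ i) (Db j $ i) x"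
  unfolding Db_def vec_lambda_beta by (rule has_partial_differentiable[OF b_differentiable])

lemma has_partial_b_inner: "has_partial j (\<lambda>z. b z \<bullet> y) (Db j \<bullet> y) x"
  unfolding inner_vec_def inner_real_def
  by (intro DERIV_sum DERIV_cmult_right has_partial_b)

lemma has_partial_a_mult: "has_partial j (\<lambda>z. (a z *v y) $ l) ((Da j *v y) $ l) x"
  unfolding matrix_vector_mult_def vec_lambda_beta
  by (intro DERIV_sum DERIV_cmult_right has_partial_a)

lemma has_partial_a_quadratic: "has_partial j (\<lambda>z. y \<bullet> (a z *v y)) (y \<bullet> (Da j *v y)) x"
  unfolding inner_vec_def[of y] inner_real_def
  by (intro DERIV_sum DERIV_cmult has_partial_a_mult)

lemma Da_sym: "Da j $ i $ k = Da j $ k $ i"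
proof -
  have "\<forall>\<^sub>F z in nhds x. a z $ i $ k = a z $ k $ i"
    using eventually_point by eventually_elim (rule finsleroid_point.sym_nth)
  from has_partial_a[of j i k, unfolded has_partial_cong[OF this]]
  show ?thesis using has_partial_a[of j k i] by (rule DERIV_unique)
qed

text \<open>The 1-form is closed: in the equation for the covariant derivative both the right side
  and the Christoffel symbols are symmetric.\<close>

lemma Db_sym: "Db j $ i = Db i $ j"
proof -
  have "christoffel a x l i j = christoffel a x l j i" for l
    using Da_sym by (simp add: christoffel_def Da_def add.commute)
  then show ?thesis
    using cov[of j i] cov[of i j] sym_nth[of i j] by (simp add: cov_deriv_def Db_def mult.commute)
qed

definition riemann_spray :: "real ^ 'n \<Rightarrow> real ^ 'n" where
  "riemann_spray y = (\<chi> i. \<Sum>n\<in>UNIV. \<Sum>m\<in>UNIV. christoffel a x i n m * y $ n * y $ m)"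

lemma a_riemann_spray:
  "(a x *v riemann_spray y) $ l = (\<Sum>j\<in>UNIV. y $ j * (Da j *v y) $ l) - 1 / 2 * (y \<bullet> (Da l *v y))"
proof -
  have "a x *v riemann_spray y =
    (\<chi> l. (\<Sum>j\<in>UNIV. y $ j * (\<Sum>n\<in>UNIV. partial j (\<lambda>z. a z $ l $ n) x * y $ n)) -
      1 / 2 * (\<Sum>m\<in>UNIV. \<Sum>n\<in>UNIV. partial l (\<lambda>z. a z $ m $ n) x * y $ m * y $ n))"
    unfolding riemann_spray_def christoffel_contract
    by (simp add: matrix_vector_mul_assoc matrix_inv_inverse posdef_invertible pos)
  then show ?thesis
    by (simp add: matrix_quadratic_sum) (simp add: Da_def matrix_vector_mult_def)
qed

text \<open>Contraction with y makes the subtracted term of \<open>a_riemann_spray\<close> half of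
  the first, so half survives.\<close>

lemma y_a_riemann_spray:
  "y \<bullet> (a x *v riemann_spray y) = 1 / 2 * (\<Sum>j\<in>UNIV. y $ j * (y \<bullet> (Da j *v y)))"
proof -
  have "(\<Sum>l\<in>UNIV. y $ l * (\<Sum>j\<in>UNIV. y $ j * (Da j *v y) $ l)) =
      (\<Sum>j\<in>UNIV. y $ j * (y \<bullet> (Da j *v y)))"
    unfolding inner_vec_def[of y] sum_distrib_left
    by (subst sum.swap) (simp add: mult_ac)
  then show ?thesis
    by (simp add: inner_vec_def[of y "a x *v _"] a_riemann_spray right_diff_distrib sum_subtractf
        flip: sum_divide_distrib)
qed

text \<open>Passing to the covariant derivative splits off
  \<open>b x \<bullet> riemann_spray y\<close>, and the hypothesis evaluates the rest as \<kappa>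
  (S^2 - b^2).\<close>

lemma Db_contract:
  "(\<Sum>j\<in>UNIV. y $ j * (Db j \<bullet> y)) = b x \<bullet> riemann_spray y + \<kappa> * q_sq (a x) (b x) y"
proof -
  have "(\<Sum>j\<in>UNIV. y $ j * (Db j \<bullet> y)) = (\<Sum>j\<in>UNIV. \<Sum>i\<in>UNIV. Db j $ i * y $ i * y $ j)"
    by (simp add: inner_vec_def sum_distrib_left mult_ac)
  also have "\<dots> = (\<Sum>i\<in>UNIV. \<Sum>j\<in>UNIV. Db j $ i * y $ i * y $ j)"
    by (rule sum.swap)
  also have "\<dots> = (\<Sum>i\<in>UNIV. \<Sum>j\<in>UNIV. (\<Sum>l\<in>UNIV. b x $ l * (christoffel a x l i j * y $ i * y $ j)) +
      \<kappa> * (a x $ i $ j * y $ i * y $ j - (b x $ i * y $ i) * (b x $ j * y $ j)))"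
  proof -
    have "Db j $ i * y $ i * y $ j =
      (\<Sum>l\<in>UNIV. b x $ l * (christoffel a x l i j * y $ i * y $ j)) +
      \<kappa> * (a x $ i $ j * y $ i * y $ j - (b x $ i * y $ i) * (b x $ j * y $ j))" for i j
    proof -
      have D: "Db j $ i = (\<Sum>l\<in>UNIV. christoffel a x l i j * b x $ l) +
          \<kappa> * (a x $ i $ j - b x $ i * b x $ j)"
        using cov[of j i] by (simp add: cov_deriv_def Db_def)
      show ?thesis
        unfolding D by (simp add: distrib_right sum_distrib_right) (simp add: algebra_simps)
    qed
    then show ?thesis by simp
  qed
  also have "\<dots> = (\<Sum>i\<in>UNIV. \<Sum>j\<in>UNIV. \<Sum>l\<in>UNIV. b x $ l * (christoffel a x l i j * y $ i * y $ j)) +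
      \<kappa> * q_sq (a x) (b x) y"
    by (simp add: sum.distrib q_sq_def matrix_quadratic_sum sum_subtractf power2_eq_square
        inner_vec_def[of "b x"] sum_product flip: sum_distrib_left)
  also have "(\<Sum>i\<in>UNIV. \<Sum>j\<in>UNIV. \<Sum>l\<in>UNIV. b x $ l * (christoffel a x l i j * y $ i * y $ j)) =
      (\<Sum>i\<in>UNIV. \<Sum>l\<in>UNIV. \<Sum>j\<in>UNIV. b x $ l * (christoffel a x l i j * y $ i * y $ j))"
    by (rule sum.cong[OF refl], rule sum.swap)
  also have "\<dots> = (\<Sum>l\<in>UNIV. \<Sum>i\<in>UNIV. \<Sum>j\<in>UNIV. b x $ l * (christoffel a x l i j * y $ i * y $ j))"
    by (rule sum.swap)
  also have "\<dots> = b x \<bullet> riemann_spray y"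
    by (simp add: inner_vec_def riemann_spray_def sum_distrib_left)
  finally show ?thesis .
qed

section \<open>The Finslerian spray at a fixed y\<close>

context
  fixes y :: "real ^ 'n"
  assumes y: "q_sq (a x) (b x) y > 0"
begin

lemma q_pos: "q y > 0"
  using y by (simp add: q_val_eq)

lemma eventually_q_sq_pos_field: "\<forall>\<^sub>F z in nhds x. q_sq (a z) (b z) y > 0"
proof -
  have c: "isCont (\<lambda>z. a z $ i $ j) x" "isCont (\<lambda>z. b z $ i) x" for i j
    by (intro differentiable_imp_continuous_within a_differentiable b_differentiable)+
  have "isCont (\<lambda>z. q_sq (a z) (b z) y) x"
    unfolding q_sq_def matrix_quadratic_sum inner_vec_def[of "b _"] inner_real_def
    by (intro continuous_diff continuous_power continuous_sum continuous_mult continuous_const c)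
  from order_tendstoD(1)[OF isCont_tendsto_nhds[OF this] y] show ?thesis .
qed

text \<open>The x-derivative of q in the form produced by \<open>q_deriv\<close>, linear in
  \<open>Da\<close> and \<open>Db\<close>.\<close>

definition Dq :: "'n \<Rightarrow> real" where
  "Dq j = (y \<bullet> (Da j *v y) - 2 * (b x \<bullet> y) * (Db j \<bullet> y)) / (2 * q y)"

lemmas field_derivs =
  g has_partial_b_inner[where y = y] has_partial_a_quadratic[where y = y]

lemma has_partial_q_field: "has_partial j (\<lambda>z. q_val (a z) (b z) y) (Dq j) x"
  using q_deriv[OF field_derivs] y unfolding q_val_eq q_sq_def Dq_def by simp

lemma has_partial_J_field:
  "has_partial j (\<lambda>z. J_bq g (b z \<bullet> y) (q_val (a z) (b z) y))
     (g * J y * (q y * (Db j \<bullet> y) - (b x \<bullet> y) * Dq j) / B y) x"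
  using J_deriv[OF field_derivs] y unfolding q_val_eq q_sq_def Dq_def by simp

lemma has_partial_F_field:
  "has_partial j (\<lambda>z. B_bq g (b z \<bullet> y) (q_val (a z) (b z) y) * J_bq g (b z \<bullet> y) (q_val (a z) (b z) y))
     (J y * (2 * g * q y * (Db j \<bullet> y) + y \<bullet> (Da j *v y))) x"
  using F_deriv[OF field_derivs] y unfolding q_val_eq q_sq_def by simp

text \<open>Parallel to \<open>matrix_mult\<close>, with \<open>Db j \<bullet> y\<close> and
  \<open>Dq j\<close> as the derivatives of b and q.\<close>

lemma has_partial_covector_field:
  "has_partial j (\<lambda>z. finsleroid_covector g (a z) (b z) y $ l)
     (g * J y * (q y * (Db j \<bullet> y) - (b x \<bullet> y) * Dq j) / B y * ((a x *v y) $ l + g * q y * b x $ l) +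
      J y * ((Da j *v y) $ l + g * Dq j * b x $ l + g * q y * Db j $ l)) x"
  unfolding finsleroid_covector_def vector_scaleR_component vector_add_component real_scaleR_def
  by (rule derivative_eq_intros has_partial_J_field has_partial_q_field has_partial_a_mult
      has_partial_b refl)+ (simp add: algebra_simps)

text \<open>Existence is enough: it makes \<open>partial\<close> a genuine derivative of each entry,
  while the contracted values come from the covector and K^2.\<close>

lemma has_partial_matrix_field:
  "\<exists>D. has_partial j (\<lambda>z. finsleroid_matrix g (a z) (b z) y $ l $ m) D x"
proof -
  have q: "q y > 0" by (rule q_pos)
  have "B y \<noteq> 0" using B_bq_pos[OF g q, of "b x \<bullet> y"] by simp
  then have nz: "B_bq g (b (x + 0 *\<^sub>R axis j 1) \<bullet> y)
      (q_val (a (x + 0 *\<^sub>R axis j 1)) (b (x + 0 *\<^sub>R axis j 1)) y) \<noteq> 0"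
    "q_val (a (x + 0 *\<^sub>R axis j 1)) (b (x + 0 *\<^sub>R axis j 1)) y \<noteq> 0"
    using q by simp_all
  note d = real_differentiable_def[THEN iffD2, OF exI]
  note diffs = has_partial_J_field[THEN d] has_partial_q_field[THEN d] has_partial_a[THEN d]
    has_partial_a_mult[THEN d] has_partial_b[THEN d] has_partial_b_inner[THEN d]
  have B: "(\<lambda>t. B_bq g (b (x + t *\<^sub>R axis j 1) \<bullet> y)
      (q_val (a (x + t *\<^sub>R axis j 1)) (b (x + t *\<^sub>R axis j 1)) y)) differentiable (at 0)"
    unfolding B_bq_def by (intro derivative_intros diffs)
  show ?thesis
    unfolding finsleroid_matrix_def Let_def vec_lambda_beta vector_minus_component
      vector_scaleR_component real_scaleR_def real_differentiable_def[symmetric]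
    by (intro derivative_intros diffs B no_zero_divisors nz)
qed

definition Dm :: "'n \<Rightarrow> 'n \<Rightarrow> 'n \<Rightarrow> real" where
  "Dm j l m = partial j (\<lambda>z. finsler_metric g a b z y $ l $ m) x"

lemma eventually_finsler_metric:
  "\<forall>\<^sub>F z in nhds x. finsler_metric g a b z y = finsleroid_matrix g (a z) (b z) y"
  using eventually_point eventually_q_sq_pos_field
  by eventually_elim (simp only: finsler_metric_def finsleroid_point.half_hessian)

lemma finsler_metric_eq: "finsler_metric g a b x y = finsleroid_matrix g (a x) (b x) y"
  by (rule eventually_nhds_x_imp_x[OF eventually_finsler_metric])

lemma has_partial_finsler_metric: "has_partial j (\<lambda>z. finsler_metric g a b z y $ l $ m) (Dm j l m) x"
proof -
  have ev: "\<forall>\<^sub>F z in nhds x. finsler_metric g a b z y $ l $ m = finsleroid_matrix g (a z) (b z) y $ l $ m"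
    using eventually_finsler_metric by eventually_elim simp
  obtain D where D: "has_partial j (\<lambda>z. finsler_metric g a b z y $ l $ m) D x"
    using has_partial_matrix_field unfolding has_partial_cong[OF ev] by blast
  then show ?thesis unfolding Dm_def partial_eqI[OF D] .
qed

lemma eventually_finsler_metric_self:
  "\<forall>\<^sub>F z in nhds x. finsler_metric g a b z y *v y = finsleroid_covector g (a z) (b z) y"
  using eventually_point eventually_q_sq_pos_field eventually_finsler_metric
  by eventually_elim (simp add: finsleroid_point.matrix_mult_self)

text \<open>With y held fixed, contraction with y commutes with the x-derivative, which then acts on
  g_ij y^j, the covector near \<open>x\<close>.\<close>

lemma Dm_contract:
  "(\<Sum>m\<in>UNIV. Dm j l m * y $ m) =
     g * J y * (q y * (Db j \<bullet> y) - (b x \<bullet> y) * Dq j) / B y * ((a x *v y) $ l + g * q y * b x $ l) +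
     J y * ((Da j *v y) $ l + g * Dq j * b x $ l + g * q y * Db j $ l)"
proof -
  have D: "has_partial j (\<lambda>z. (finsler_metric g a b z y *v y) $ l) (\<Sum>m\<in>UNIV. Dm j l m * y $ m) x"
    unfolding matrix_vector_mult_def vec_lambda_beta
    by (intro DERIV_sum DERIV_cmult_right has_partial_finsler_metric)
  have ev: "\<forall>\<^sub>F z in nhds x. (finsler_metric g a b z y *v y) $ l =
      finsleroid_covector g (a z) (b z) y $ l"
    using eventually_finsler_metric_self by eventually_elim simp
  show ?thesis
    using D[unfolded has_partial_cong[OF ev]] has_partial_covector_field by (rule DERIV_unique)
qed

text \<open>The same argument for g_ij y^i y^j = K^2.\<close>

lemma Dm_contract2:
  "(\<Sum>m\<in>UNIV. \<Sum>n\<in>UNIV. Dm j m n * y $ m * y $ n) =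
     J y * (2 * g * q y * (Db j \<bullet> y) + y \<bullet> (Da j *v y))"
proof -
  have D: "has_partial j (\<lambda>z. y \<bullet> (finsler_metric g a b z y *v y))
      (\<Sum>m\<in>UNIV. \<Sum>n\<in>UNIV. Dm j m n * y $ m * y $ n) x"
    unfolding matrix_quadratic_sum
    by (intro DERIV_sum DERIV_cmult_right has_partial_finsler_metric)
  have ev: "\<forall>\<^sub>F z in nhds x. y \<bullet> (finsler_metric g a b z y *v y) =
      B_bq g (b z \<bullet> y) (q_val (a z) (b z) y) * J_bq g (b z \<bullet> y) (q_val (a z) (b z) y)"
    using eventually_finsler_metric_self eventually_point
    by eventually_elim (simp add: finsleroid_point.covector_self)
  show ?thesis
    using D[unfolded has_partial_cong[OF ev]] has_partial_F_field by (rule DERIV_unique)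
qed

text \<open>The left side is the spray with its index lowered. Its contracted derivatives have the
  shape of \<open>matrix_mult\<close> at the vector on the right; the terms in \<kappa> by which
  they differ cancel for the coefficient \<kappa> g.\<close>

lemma euler_lagrange:
  "(\<chi> l. (\<Sum>j\<in>UNIV. y $ j * (\<Sum>n\<in>UNIV. Dm j l n * y $ n)) -
      1 / 2 * (\<Sum>m\<in>UNIV. \<Sum>n\<in>UNIV. Dm l m n * y $ m * y $ n)) =
   finsleroid_matrix g (a x) (b x) y *v (riemann_spray y + (\<kappa> * g * q y) *\<^sub>R v y)"
proof -
  define w where "w = riemann_spray y + (\<kappa> * g * q y) *\<^sub>R v y"
  \<comment> \<open>The letter \<open>Y\<close> marks x-derivatives in the direction y with y fixed,
    of S^2, b and q; \<open>T\<close> is that of a_lm y^m.\<close>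
  define T where "T l = (\<Sum>j\<in>UNIV. y $ j * (Da j *v y) $ l)" for l
  define \<sigma>Y where "\<sigma>Y = (\<Sum>j\<in>UNIV. y $ j * (y \<bullet> (Da j *v y)))"
  define bY where "bY = (\<Sum>j\<in>UNIV. y $ j * (Db j \<bullet> y))"
  define qY where "qY = (\<Sum>j\<in>UNIV. y $ j * Dq j)"
  define bz where "bz = b x \<bullet> riemann_spray y"
  define c where "c = g * J y"
  have q: "q y > 0" by (rule q_pos)
  have B: "B y > 0" by (rule B_bq_pos[OF g q])
  have qY: "qY = (\<sigma>Y - 2 * (b x \<bullet> y) * bY) / (2 * q y)"
  proof -
    have "qY = (\<Sum>j\<in>UNIV. (y $ j * (y \<bullet> (Da j *v y)) - 2 * (b x \<bullet> y) * (y $ j * (Db j \<bullet> y))) / (2 * q y))"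
      by (simp add: qY_def Dq_def algebra_simps)
    then show ?thesis
      by (simp only: \<sigma>Y_def bY_def sum_subtractf sum_distrib_left flip: sum_divide_distrib)
  qed
  have bY: "bY = bz + \<kappa> * (q y)\<^sup>2"
    by (simp add: bY_def bz_def Db_contract q_square)
  have bw: "b x \<bullet> w = bz"
    by (simp add: w_def bz_def inner_add_right b_v)
  have uw: "u y \<bullet> w = \<sigma>Y / 2 - (b x \<bullet> y) * bz + \<kappa> * g * q y * (q y)\<^sup>2"
    by (simp add: w_def bz_def \<sigma>Y_def inner_add_right u_v q_square)
      (simp add: u_inner y_a_riemann_spray)
  have uwq: "(u y \<bullet> w) / q y = qY + \<kappa> * (b x \<bullet> y) * q y + \<kappa> * g * (q y)\<^sup>2"
    unfolding uw qY bY using q by (simp add: field_simps power2_eq_square)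
  \<comment> \<open>The \<kappa> terms add up to a multiple of B, which cancels the denominator in
    \<open>matrix_mult\<close>.\<close>
  have k: "q y * bz - (b x \<bullet> y) * ((u y \<bullet> w) / q y) = (q y * bY - (b x \<bullet> y) * qY) - \<kappa> * q y * B y"
    unfolding uwq bY by (simp add: B_bq_def algebra_simps power2_eq_square)
  have aw: "(a x *v w) $ l = T l - 1 / 2 * (y \<bullet> (Da l *v y)) +
      \<kappa> * g * q y * ((a x *v y) $ l - (b x \<bullet> y) * b x $ l)" for l
    by (simp add: w_def matrix_vector_right_distrib matrix_vector_mult_scaleR a_riemann_spray T_def
        u_eq flip: v_low_eq_mult)
  \<comment> \<open>Closedness of b; the resulting term cancels against its counterpart in
    \<open>Dm_contract2\<close>.\<close>
  have Db: "(\<Sum>j\<in>UNIV. y $ j * Db j $ l) = Db l \<bullet> y" for l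
    by (simp add: inner_vec_def Db_sym[of _ l] mult.commute)
  have S: "(\<Sum>j\<in>UNIV. y $ j * (\<Sum>n\<in>UNIV. Dm j l n * y $ n)) =
     c * (q y * bY - (b x \<bullet> y) * qY) / B y * ((a x *v y) $ l + g * q y * b x $ l) +
     J y * (T l + g * qY * b x $ l + g * q y * (Db l \<bullet> y))" (is "_ = ?R") for l
  proof -
    define X where "X = (a x *v y) $ l + g * q y * b x $ l"
    have "y $ j * (\<Sum>n\<in>UNIV. Dm j l n * y $ n) =
        c * q y / B y * X * (y $ j * (Db j \<bullet> y)) - c * (b x \<bullet> y) / B y * X * (y $ j * Dq j) +
        J y * (y $ j * (Da j *v y) $ l) + J y * g * b x $ l * (y $ j * Dq j) +
        J y * g * q y * (y $ j * Db j $ l)" for j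
      unfolding Dm_contract X_def[symmetric] c_def[symmetric]
      by (simp add: algebra_simps diff_divide_distrib)
    then have "(\<Sum>j\<in>UNIV. y $ j * (\<Sum>n\<in>UNIV. Dm j l n * y $ n)) =
        c * q y / B y * X * bY - c * (b x \<bullet> y) / B y * X * qY +
        J y * T l + J y * g * b x $ l * qY + J y * g * q y * (Db l \<bullet> y)"
      by (simp only: sum.distrib sum_subtractf bY_def qY_def T_def Db flip: sum_distrib_left)
    also have "\<dots> = ?R"
      unfolding X_def[symmetric] by (simp add: algebra_simps diff_divide_distrib)
    finally show ?thesis .
  qed
  have "(finsleroid_matrix g (a x) (b x) y *v w) $ l =
      (\<Sum>j\<in>UNIV. y $ j * (\<Sum>n\<in>UNIV. Dm j l n * y $ n)) -
      1 / 2 * (\<Sum>m\<in>UNIV. \<Sum>n\<in>UNIV. Dm l m n * y $ m * y $ n)" for l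
  proof -
    define X where "X = (a x *v y) $ l + g * q y * b x $ l"
    define P where "P = q y * bY - (b x \<bullet> y) * qY"
    define Z where "Z = c * P / B y * X"
    have Z: "c * (P - \<kappa> * q y * B y) / B y * X = Z - c * \<kappa> * q y * X"
      using B by (simp add: Z_def right_diff_distrib left_diff_distrib diff_divide_distrib)
    \<comment> \<open>With \<open>Z\<close> standing for the quotient by B, a polynomial identity is
      left, in which the \<kappa> terms cancel.\<close>
    show ?thesis
      unfolding matrix_mult[OF y] S Dm_contract2 bw k aw
      unfolding uwq X_def[symmetric] P_def[symmetric] c_def[symmetric]
      unfolding Z Z_def[symmetric]
      unfolding X_def c_def by algebra
  qed
  then show ?thesis
    by (simp add: vec_eq_iff w_def)
qed

text \<open>\<open>euler_lagrange\<close> exhibits the lowered spray as g_ij times a vector, so the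
  inverse metric cancels.\<close>

lemma spray_eq: "spray g a b x y i = landsberg_spray (\<kappa> * g) a b x y i"
proof -
  have "spray g a b x y i = (riemann_spray y + (\<kappa> * g * q y) *\<^sub>R v y) $ i"
    using christoffel_contract[of "\<lambda>z. finsler_metric g a b z y" x y]
    unfolding euler_lagrange[unfolded Dm_def] finsler_metric_eq matrix_inverse_mult[OF y]
    by (simp add: spray_def finsler_christoffel_def vec_eq_iff)
  then show ?thesis
    by (simp add: landsberg_spray_def riemann_spray_def)
qed

end

text \<open>At fixed x the formula of \<open>spray_eq\<close> holds for all y with q > 0, hence may
  be differentiated in y; the Christoffel symbols of a are constants there.\<close>

lemma spray_deriv3_eq:
  assumes "q_sq (a x) (b x) y > 0"
  shows "spray_deriv3 g a b x y i l m n = \<kappa> * g / q y *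
    (eta_mix (a x) (b x) y i l * eta_low (a x) (b x) y m n +
     eta_mix (a x) (b x) y i m * eta_low (a x) (b x) y l n +
     eta_mix (a x) (b x) y i n * eta_low (a x) (b x) y l m)"
  unfolding spray_deriv3_def
proof (rule partial3_spray[OF assms, where \<Gamma> = "\<chi> k m. christoffel a x i k m"])
  show "spray g a b x w i = \<kappa> * g * q w * v w $ i + w \<bullet> ((\<chi> k m. christoffel a x i k m) *v w)"
    if "q_sq (a x) (b x) w > 0" for w
    using spray_eq[OF that, of i] by (simp add: landsberg_spray_def matrix_quadratic_sum)
qed

end

section \<open>From charts to the manifold\<close>

lemma smooth_on_differentiable: "smooth_on f U \<Longrightarrow> x \<in> U \<Longrightarrow> f differentiable (at x)"
  unfolding smooth_on_def by (drule spec[of _ "Suc 0"]) simp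

theorem proposition2:
  fixes M :: "'m topology"
    and atlas :: "('m, 'n::finite) chart set"
    and a :: "('m, 'n) chart \<Rightarrow> real ^ 'n \<Rightarrow> real ^ 'n ^ 'n"
    and b :: "('m, 'n) chart \<Rightarrow> real ^ 'n \<Rightarrow> real ^ 'n"
    and g :: real
    and k :: "'m \<Rightarrow> real"
  assumes "CARD('n) \<ge> 2"
    and "smooth_manifold M atlas"
    and "riemannian_metric atlas a"
    and "one_form atlas b"
    and "\<forall>ch\<in>atlas. \<forall>x \<in> coord ch ` chart_dom ch. covector_norm_sq (a ch x) (b ch x) = 1"
    and "- 2 < g" and "g < 2"
    and "\<forall>ch\<in>atlas. \<forall>p \<in> chart_dom ch. \<forall>i j.
           cov_deriv (a ch) (b ch) (coord ch p) j i =
             k p * (a ch (coord ch p) $ i $ j - b ch (coord ch p) $ i * b ch (coord ch p) $ j)"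
  shows "landsberg_type atlas a b (\<lambda>ch. spray g (a ch) (b ch)) \<and>
    (\<forall>ch\<in>atlas. \<forall>p \<in> chart_dom ch. \<forall>y.
       let x = coord ch p; c = k p * g; q = q_val (a ch x) (b ch x) y;
           \<eta>_mix = eta_mix (a ch x) (b ch x) y; \<eta>_low = eta_low (a ch x) (b ch x) y in
       y \<noteq> 0 \<longrightarrow> q \<noteq> 0 \<longrightarrow>
         (\<forall>i. spray g (a ch) (b ch) x y i = landsberg_spray c (a ch) (b ch) x y i) \<and>
         (\<forall>i l m n. spray_deriv3 g (a ch) (b ch) x y i l m n =
            c / q * (\<eta>_mix i l * \<eta>_low m n + \<eta>_mix i m * \<eta>_low l n + \<eta>_mix i n * \<eta>_low l m)))"
proof -
  have field: "finsleroid_field (a ch) (b ch) g (coord ch p) (k p)"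
    if ch: "ch \<in> atlas" and p: "p \<in> chart_dom ch" for ch p
  proof
    let ?U = "coord ch ` chart_dom ch"
    have x: "coord ch p \<in> ?U" using p by simp
    \<comment> \<open>The chart image is open, so conditions assumed at each of its points hold on a
      neighbourhood.\<close>
    have "open ?U" using assms(2) ch by (simp add: smooth_manifold_def)
    then have "\<forall>\<^sub>F z in nhds (coord ch p). z \<in> ?U" using x by (rule eventually_nhds_in_open)
    then show "\<forall>\<^sub>F z in nhds (coord ch p). finsleroid_point (a ch z) (b ch z) g"
    proof eventually_elim
      case (elim z)
      have "a ch z $ i $ j = a ch z $ j $ i" for i j
        using assms(3) ch elim unfolding riemannian_metric_def by blast
      moreover have "(\<Sum>i\<in>UNIV. \<Sum>j\<in>UNIV. a ch z $ i $ j * y $ i * y $ j) > 0" if "y \<noteq> 0" for y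
        using assms(3) ch elim that unfolding riemannian_metric_def by blast
      ultimately show ?case
        using assms(5-7) ch elim
        by unfold_locales (auto simp: transpose_def vec_eq_iff matrix_quadratic_sum)
    qed
    show "(\<lambda>z. a ch z $ i $ j) differentiable at (coord ch p)" for i j
      using assms(3) ch x unfolding riemannian_metric_def
      by (blast intro: smooth_on_differentiable)
    show "(\<lambda>z. b ch z $ i) differentiable at (coord ch p)" for i
      using assms(4) ch x unfolding one_form_def by (blast intro: smooth_on_differentiable)
    show "cov_deriv (a ch) (b ch) (coord ch p) j i =
        k p * (a ch (coord ch p) $ i $ j - b ch (coord ch p) $ i * b ch (coord ch p) $ j)" for i j
      using assms(8) ch p by blast
  qed
  have q_sq: "q_sq (a ch (coord ch p)) (b ch (coord ch p)) y > 0"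
    if "ch \<in> atlas" "p \<in> chart_dom ch" "q_val (a ch (coord ch p)) (b ch (coord ch p)) y \<noteq> 0"
    for ch p y
    using finsleroid_point.q_pos_iff[OF eventually_nhds_x_imp_x[OF
          finsleroid_field.eventually_point[OF field[OF that(1,2)]]]] that(3) by blast
  note eqs = finsleroid_field.spray_eq[OF field q_sq] finsleroid_field.spray_deriv3_eq[OF field q_sq]
  \<comment> \<open>The witness \<open>\<lambda>p. k p * g\<close> is a function on the manifold,
    the same for every chart.\<close>
  show ?thesis
    unfolding landsberg_type_def Let_def using eqs
    by (intro conjI exI[of _ "\<lambda>p. k p * g"]) simp_all
qed

end
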